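(* The image of $\rho'_{\sqrt3/2}:G(3_1)\to PSL(2,\mathbb C)$ acts on the Euclidean plane $\mathbb C$ as the holonomy of the Euclidean crystallographic orbifold $S^2_{2,3,6}$.
   Context: $G(3_1)=\langle a,b\mid aba=bab\rangle$ is the trefoil knot group. The representation $\rho_{\sqrt3/2}:G(3_1)\to SL(2,\mathbb C)$ is $$a\mapsto\begin{pmatrix}\frac{\sqrt3}{2}+\frac{\sqrt{-1}}{2}&0\\0&\frac{\sqrt3}{2}-\frac{\sqrt{-1}}{2}\end{pmatrix},\qquad b\mapsto\begin{pmatrix}\frac{\sqrt3}{2}+\frac{\sqrt{-1}}{2}&0\\1&\frac{\sqrt3}{2}-\frac{\sqrt{-1}}{2}\end{pmatrix},$$ and $\rho'_{\sqrt3/2}$ is its composition with $SL(2,\mathbb C)\to PSL(2,\mathbb C)$, considered up to conjugation (so that the common fixed point in $\mathbb CP^1$ is moved to $\infty$ by $w=-1/z$). In this form $\rho'_{\sqrt3/2}(a)$ is the $\frac{2\pi}{6}$-rotation $z\mapsto e^{i\frac{2\pi}{6}}z$ about $0$ and $\rho'_{\sqrt3/2}(b)$ is the $\frac{2\pi}{6}$-rotation $z\mapsto e^{i\frac{2\pi}{6}}z+e^{i\frac{\pi}{6}}$ about the point $i$. $S^2_{2,3,6}$ is the Euclidean 2-orbifold with underlying space the 2-sphere and three cone points of orders $2,3,6$. Its holonomy is the orientation-preserving wallpaper group $p6$, unique up to similarity. *)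

theory Defs
  imports "HOL-Analysis.Analysis" "HOL-Algebra.Algebra"
begin

section \<open>Groups given by a presentation\<close>

text \<open>
  A letter \<open>(x, True)\<close> stands for the generator \<open>x\<close> and \<open>(x, False)\<close> for its formal inverse.
  The group \<open>\<langle>'g | R\<rangle>\<close> consists of the classes of words under the congruence generated by free
  cancellation and by \<open>u = v\<close> for \<open>(u, v) \<in> R\<close>.
\<close>

type_synonym 'g gword = "('g \<times> bool) list"

inductive word_eq :: "('g gword \<times> 'g gword) set \<Rightarrow> 'g gword \<Rightarrow> 'g gword \<Rightarrow> bool"
  for R where
  relator: "(u, v) \<in> R \<Longrightarrow> word_eq R u v"
| cancel: "word_eq R [(x, e), (x, \<not> e)] []"
| refl: "word_eq R u u"
| sym: "word_eq R u v \<Longrightarrow> word_eq R v u"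
| trans: "word_eq R u v \<Longrightarrow> word_eq R v w \<Longrightarrow> word_eq R u w"
| app: "word_eq R u u' \<Longrightarrow> word_eq R v v' \<Longrightarrow> word_eq R (u @ v) (u' @ v')"

definition word_class :: "('g gword \<times> 'g gword) set \<Rightarrow> 'g gword \<Rightarrow> 'g gword set" where
  "word_class R u = {v. word_eq R u v}"

definition presented_group :: "('g gword \<times> 'g gword) set \<Rightarrow> 'g gword set monoid" where
  "presented_group R =
    \<lparr>carrier = range (word_class R),
     mult = (\<lambda>C D. \<Union>u\<in>C. \<Union>v\<in>D. word_class R (u @ v)),
     one = word_class R []\<rparr>"

definition eval_word :: "('h, 'm) monoid_scheme \<Rightarrow> ('g \<Rightarrow> 'h) \<Rightarrow> 'g gword \<Rightarrow> 'h" where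
  "eval_word H f w =
    foldr (\<lambda>(x, e) y. (if e then f x else inv\<^bsub>H\<^esub> (f x)) \<otimes>\<^bsub>H\<^esub> y) w \<one>\<^bsub>H\<^esub>"

text \<open>
  The homomorphism out of \<open>\<langle>'g | R\<rangle>\<close> extending \<open>f\<close>; see \<open>presented_hom_hom\<close> and
  \<open>presented_hom_gen\<close> below.
\<close>

definition presented_hom :: "('h, 'm) monoid_scheme \<Rightarrow> ('g \<Rightarrow> 'h) \<Rightarrow> 'g gword set \<Rightarrow> 'h" where
  "presented_hom H f C = the_elem (eval_word H f ` C)"

lemma word_class_eq_iff: "word_class R u = word_class R v \<longleftrightarrow> word_eq R u v"
  unfolding word_class_def
  by (auto intro: word_eq.refl word_eq.sym word_eq.trans)

lemma presented_group_mult: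
  "word_class R u \<otimes>\<^bsub>presented_group R\<^esub> word_class R v = word_class R (u @ v)"
proof -
  have "word_class R (u' @ v') = word_class R (u @ v)"
    if "u' \<in> word_class R u" "v' \<in> word_class R v" for u' v'
  proof -
    have "word_eq R u' u" "word_eq R v' v"
      using that unfolding word_class_def by (blast intro: word_eq.sym)+
    then show ?thesis
      unfolding word_class_eq_iff by (rule word_eq.app)
  qed
  moreover have "u \<in> word_class R u" "v \<in> word_class R v"
    by (simp_all add: word_class_def word_eq.refl)
  ultimately have "(\<Union>u'\<in>word_class R u. \<Union>v'\<in>word_class R v. word_class R (u' @ v')) =
      word_class R (u @ v)"
    by blast
  then show ?thesis
    by (simp add: presented_group_def)
qed

lemma word_eq_inverse:
  "word_eq R (map (\<lambda>(x, e). (x, \<not> e)) (rev u) @ u) []"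
proof (induction u)
  case Nil
  show ?case by (simp add: word_eq.refl)
next
  case (Cons a u)
  obtain x e where a: "a = (x, e)" by (cases a)
  let ?w = "map (\<lambda>(x, e). (x, \<not> e)) (rev u)"
  have "word_eq R [(x, \<not> e), (x, \<not> \<not> e)] []" by (rule word_eq.cancel)
  then have "word_eq R (?w @ ([(x, \<not> e), (x, e)] @ u)) (?w @ ([] @ u))"
    by (intro word_eq.app word_eq.refl) simp
  then have "word_eq R (?w @ [(x, \<not> e), (x, e)] @ u) (?w @ u)"
    by simp
  then have "word_eq R (?w @ [(x, \<not> e), (x, e)] @ u) []"
    using Cons.IH by (rule word_eq.trans)
  then show ?case
    by (simp add: a)
qed

lemma group_presented_group: "group (presented_group R)"
proof (rule groupI)
  fix C D E
  assume "C \<in> carrier (presented_group R)" "D \<in> carrier (presented_group R)"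
    "E \<in> carrier (presented_group R)"
  then show "C \<otimes>\<^bsub>presented_group R\<^esub> D \<otimes>\<^bsub>presented_group R\<^esub> E =
      C \<otimes>\<^bsub>presented_group R\<^esub> (D \<otimes>\<^bsub>presented_group R\<^esub> E)"
    by (auto simp: presented_group_mult presented_group_def[THEN arg_cong, of carrier])
next
  fix C
  assume "C \<in> carrier (presented_group R)"
  then obtain u where C: "C = word_class R u"
    by (auto simp: presented_group_def)
  have one: "\<one>\<^bsub>presented_group R\<^esub> = word_class R []"
    by (simp add: presented_group_def)
  show "\<one>\<^bsub>presented_group R\<^esub> \<otimes>\<^bsub>presented_group R\<^esub> C = C"
    by (simp add: one C presented_group_mult)
  show "\<exists>D\<in>carrier (presented_group R). D \<otimes>\<^bsub>presented_group R\<^esub> C = \<one>\<^bsub>presented_group R\<^esub>"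
    by (rule bexI[of _ "word_class R (map (\<lambda>(x, e). (x, \<not> e)) (rev u))"])
      (simp_all add: one C presented_group_mult word_class_eq_iff word_eq_inverse,
       simp add: presented_group_def)
qed (auto simp: presented_group_mult presented_group_def[THEN arg_cong, of carrier]
       presented_group_def[THEN arg_cong, of one])

context group
begin

lemma eval_word_Nil [simp]: "eval_word G f [] = \<one>"
  by (simp add: eval_word_def)

lemma eval_word_Cons:
  "eval_word G f ((x, e) # w) = (if e then f x else inv (f x)) \<otimes> eval_word G f w"
  by (simp add: eval_word_def)

lemma eval_word_closed: "f \<in> UNIV \<rightarrow> carrier G \<Longrightarrow> eval_word G f w \<in> carrier G"
  by (induction w) (auto simp: eval_word_Cons Pi_iff)

lemma eval_word_append:
  "f \<in> UNIV \<rightarrow> carrier G \<Longrightarrow> eval_word G f (u @ v) = eval_word G f u \<otimes> eval_word G f v"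
proof (induction u)
  case (Cons a u)
  then show ?case
    by (cases a) (auto simp: eval_word_Cons eval_word_closed m_assoc Pi_iff)
qed (simp add: eval_word_closed)

lemma eval_word_eq:
  assumes f: "f \<in> UNIV \<rightarrow> carrier G"
    and R: "\<And>u v. (u, v) \<in> R \<Longrightarrow> eval_word G f u = eval_word G f v"
    and "word_eq R u v"
  shows "eval_word G f u = eval_word G f v"
  using assms(3)
proof induction
  case (cancel x e)
  have "f x \<in> carrier G" using f by auto
  then show ?case by (simp add: eval_word_Cons)
qed (auto simp: R eval_word_append f)

lemma presented_hom_class:
  assumes "f \<in> UNIV \<rightarrow> carrier G"
    and "\<And>u v. (u, v) \<in> R \<Longrightarrow> eval_word G f u = eval_word G f v"
  shows "presented_hom G f (word_class R u) = eval_word G f u"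
proof -
  have "eval_word G f ` word_class R u = {eval_word G f u}"
    using eval_word_eq[OF assms] by (auto simp: word_class_def intro: word_eq.refl)
  then show ?thesis by (simp add: presented_hom_def)
qed

lemma presented_hom_hom:
  assumes "f \<in> UNIV \<rightarrow> carrier G"
    and "\<And>u v. (u, v) \<in> R \<Longrightarrow> eval_word G f u = eval_word G f v"
  shows "presented_hom G f \<in> hom (presented_group R) G"
proof (rule homI)
  fix C assume "C \<in> carrier (presented_group R)"
  then show "presented_hom G f C \<in> carrier G"
    using assms by (auto simp: presented_group_def presented_hom_class eval_word_closed)
next
  fix C D assume "C \<in> carrier (presented_group R)" "D \<in> carrier (presented_group R)"
  then show "presented_hom G f (C \<otimes>\<^bsub>presented_group R\<^esub> D) = presented_hom G f C \<otimes> presented_hom G f D"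
    using assms by (auto simp: presented_group_mult presented_hom_class eval_word_append
        presented_group_def[THEN arg_cong, of carrier])
qed

lemma presented_hom_gen:
  assumes "f \<in> UNIV \<rightarrow> carrier G"
    and "\<And>u v. (u, v) \<in> R \<Longrightarrow> eval_word G f u = eval_word G f v"
  shows "presented_hom G f (word_class R [(x, True)]) = f x"
  using presented_hom_class[OF assms, where u = "[(x, True)]"] assms(1)
  by (auto simp: eval_word_Cons Pi_iff)

end


section \<open>The trefoil group\<close>

datatype trefoil_gen = Gen_a | Gen_b

definition trefoil_relators :: "(trefoil_gen gword \<times> trefoil_gen gword) set" where
  "trefoil_relators =
    {([(Gen_a, True), (Gen_b, True), (Gen_a, True)], [(Gen_b, True), (Gen_a, True), (Gen_b, True)])}"

definition trefoil_group :: "trefoil_gen gword set monoid" where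
  "trefoil_group = presented_group trefoil_relators"


section \<open>\<open>SL(2,\<complex>)\<close>, \<open>PSL(2,\<complex>)\<close> and the action on \<open>\<complex>P\<^sup>1\<close>\<close>

definition SL2C :: "(complex^2^2) monoid" where
  "SL2C = \<lparr>carrier = {M. det M = 1}, mult = (**), one = mat 1\<rparr>"

definition PSL2C :: "(complex^2^2) set monoid" where
  "PSL2C = SL2C Mod {mat 1, - mat 1}"

definition to_PSL2C :: "complex^2^2 \<Rightarrow> (complex^2^2) set" where
  "to_PSL2C M = {mat 1, - mat 1} #>\<^bsub>SL2C\<^esub> M"

text \<open>\<open>\<complex>P\<^sup>1\<close> is \<open>\<complex> \<union> {\<infinity>}\<close>, with \<open>None\<close> as the point \<open>\<infinity>\<close>.\<close>

fun mobius_act :: "complex^2^2 \<Rightarrow> complex option \<Rightarrow> complex option" where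
  "mobius_act M (Some z) =
    (if M$2$1 * z + M$2$2 = 0 then None
     else Some (moebius (M$1$1) (M$1$2) (M$2$1) (M$2$2) z))"
| "mobius_act M None = (if M$2$1 = 0 then None else Some (M$1$1 / M$2$1))"

text \<open>Both matrices of a class in \<open>PSL(2,\<complex>)\<close> induce the same transformation.\<close>

definition psl_act :: "(complex^2^2) set \<Rightarrow> complex option \<Rightarrow> complex option" where
  "psl_act C p = the_elem ((\<lambda>M. mobius_act M p) ` C)"

text \<open>Only meaningful for classes \<open>C\<close> that fix \<open>\<infinity>\<close>.\<close>

definition plane_act :: "(complex^2^2) set \<Rightarrow> complex \<Rightarrow> complex" where
  "plane_act C z = the (psl_act C (Some z))"

lemma group_SL2C: "group SL2C"
proof (rule groupI)
  fix M assume M: "M \<in> carrier SL2C"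
  then have "invertible M" by (simp add: SL2C_def invertible_det_nz)
  then obtain N where N: "N ** M = mat 1"
    by (auto simp: invertible_def)
  with M have "det N = 1"
    using det_mul[of N M] by (simp add: SL2C_def)
  with N show "\<exists>N\<in>carrier SL2C. N \<otimes>\<^bsub>SL2C\<^esub> M = \<one>\<^bsub>SL2C\<^esub>"
    by (auto simp: SL2C_def)
qed (auto simp: SL2C_def det_mul matrix_mul_assoc)

lemma normal_center_SL2C: "{mat 1, - mat 1} \<lhd> SL2C"
proof -
  interpret group SL2C by (rule group_SL2C)
  have neg: "(- mat 1) ** M = - M" "M ** (- mat 1) = - M" for M :: "complex^2^2"
    by (simp_all add: vec_eq_iff forall_2 matrix_matrix_mult_def sum_2 mat_def)
  have carr: "- mat 1 \<in> carrier SL2C"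
    by (simp add: SL2C_def det_2 mat_def)
  have sq: "- mat 1 \<otimes>\<^bsub>SL2C\<^esub> - mat 1 = \<one>\<^bsub>SL2C\<^esub>"
    by (simp add: SL2C_def neg)
  have inv: "inv\<^bsub>SL2C\<^esub> (- mat 1) = - mat 1"
    using inv_equality[OF sq carr carr] .
  have one: "\<one>\<^bsub>SL2C\<^esub> = mat 1" by (simp add: SL2C_def)
  have "mat 1 \<in> carrier SL2C" using one_closed by (simp add: one)
  moreover have "inv\<^bsub>SL2C\<^esub> (mat 1) = mat 1" using inv_one by (simp add: one)
  moreover have "g \<otimes>\<^bsub>SL2C\<^esub> h \<in> {mat 1, - mat 1}"
    if "g \<in> {mat 1, - mat 1}" "h \<in> {mat 1, - mat 1}" for g h
    using that by (auto simp: SL2C_def neg)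
  ultimately have sub: "subgroup {mat 1, - mat 1} SL2C"
    using carr inv by (intro subgroupI) blast+
  show ?thesis
    unfolding normal_inv_iff
  proof (intro conjI ballI)
    fix M h assume M: "M \<in> carrier SL2C" and h: "h \<in> {mat 1, - mat 1 :: complex^2^2}"
    have hc: "h \<in> carrier SL2C" using h subgroup.subset[OF sub] by blast
    have "M \<otimes>\<^bsub>SL2C\<^esub> h = h \<otimes>\<^bsub>SL2C\<^esub> M"
      using h by (auto simp: SL2C_def neg)
    then have "M \<otimes>\<^bsub>SL2C\<^esub> h \<otimes>\<^bsub>SL2C\<^esub> inv\<^bsub>SL2C\<^esub> M = h"
      using M hc by (simp add: m_assoc)
    with h show "M \<otimes>\<^bsub>SL2C\<^esub> h \<otimes>\<^bsub>SL2C\<^esub> inv\<^bsub>SL2C\<^esub> M \<in> {mat 1, - mat 1}" by simp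
  qed (rule sub)
qed

lemma group_PSL2C: "group PSL2C"
  unfolding PSL2C_def by (rule normal.factorgroup_is_group[OF normal_center_SL2C])

lemma to_PSL2C_eq: "to_PSL2C M = {M, - M}"
proof -
  have "(- mat 1) ** M = - M"
    by (simp add: vec_eq_iff forall_2 matrix_matrix_mult_def sum_2 mat_def)
  then show ?thesis by (auto simp: to_PSL2C_def r_coset_def SL2C_def)
qed

lemma psl_act_to_PSL2C: "psl_act (to_PSL2C M) p = mobius_act M p"
proof -
  have "mobius_act (- M) p = mobius_act M p"
  proof (cases p)
    case (Some z)
    have neg: "(- M)$i$1 * z + (- M)$i$2 = - (M$i$1 * z + M$i$2)" for i
      by simp
    show ?thesis
      unfolding Some mobius_act.simps moebius_def neg minus_divide_divide neg_equal_0_iff_equal ..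
  qed simp
  then show ?thesis by (simp add: psl_act_def to_PSL2C_eq)
qed


section \<open>The representation\<close>

fun rho_gen :: "trefoil_gen \<Rightarrow> complex^2^2" where
  "rho_gen Gen_a = vector [vector [Complex (sqrt 3 / 2) (1 / 2), 0],
                           vector [0, Complex (sqrt 3 / 2) (- 1 / 2)]]"
| "rho_gen Gen_b = vector [vector [Complex (sqrt 3 / 2) (1 / 2), 0],
                           vector [1, Complex (sqrt 3 / 2) (- 1 / 2)]]"

definition rho :: "trefoil_gen gword set \<Rightarrow> complex^2^2" where
  "rho = presented_hom SL2C rho_gen"

definition rho' :: "trefoil_gen gword set \<Rightarrow> (complex^2^2) set" where
  "rho' x = to_PSL2C (rho x)"

text \<open>The class of the change of coordinate \<open>w = -1/z\<close>.\<close>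

definition flip :: "(complex^2^2) set" where
  "flip = to_PSL2C (vector [vector [0, - 1], vector [1, 0]])"

text \<open>
  The conjugate of \<open>rho'\<close> whose common fixed point is \<open>\<infinity>\<close>. With matrices acting from the left it
  sends the generators to the inverses of the rotations \<open>z \<mapsto> cis (\<pi>/3) z\<close> and
  \<open>z \<mapsto> cis (\<pi>/3) z + cis (\<pi>/6)\<close> about \<open>0\<close> and \<open>\<i>\<close>, so its image is the group generated by these
  two rotations.
\<close>

definition rho'_inf :: "trefoil_gen gword set \<Rightarrow> (complex^2^2) set" where
  "rho'_inf x = flip \<otimes>\<^bsub>PSL2C\<^esub> rho' x \<otimes>\<^bsub>PSL2C\<^esub> inv\<^bsub>PSL2C\<^esub> flip"

lemma rho_gen_closed: "rho_gen \<in> UNIV \<rightarrow> carrier SL2C"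
proof
  fix x show "rho_gen x \<in> carrier SL2C"
    by (cases x) (simp_all add: SL2C_def det_2 complex_eq_iff power2_eq_square[symmetric] power_divide)
qed

lemma rho_gen_relator:
  assumes "(u, v) \<in> trefoil_relators"
  shows "eval_word SL2C rho_gen u = eval_word SL2C rho_gen v"
proof -
  interpret group SL2C by (rule group_SL2C)
  let ?A = "rho_gen Gen_a" and ?B = "rho_gen Gen_b"
  have "?A ** (?B ** ?A) = ?B ** (?A ** ?B)"
    by (simp add: vec_eq_iff forall_2 matrix_matrix_mult_def sum_2 complex_eq_iff field_simps)
  then show ?thesis
    using assms by (simp add: trefoil_relators_def eval_word_def SL2C_def)
qed

lemma rho_hom: "rho \<in> hom trefoil_group SL2C"
  unfolding rho_def trefoil_group_def
  by (rule group.presented_hom_hom[OF group_SL2C rho_gen_closed rho_gen_relator])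

lemma rho_generator: "rho (word_class trefoil_relators [(x, True)]) = rho_gen x"
  unfolding rho_def
  by (rule group.presented_hom_gen[OF group_SL2C rho_gen_closed rho_gen_relator])

lemma rho'_inf_eq:
  assumes "rho x = vector [vector [p, q], vector [r, s]]" and "x \<in> carrier trefoil_group"
  shows "rho'_inf x = to_PSL2C (vector [vector [s, - r], vector [- q, p]])"
proof -
  let ?W = "vector [vector [0, - 1], vector [1, 0]] :: complex^2^2"
  let ?V = "vector [vector [0, 1], vector [- 1, 0]] :: complex^2^2"
  interpret normal "{mat 1, - mat 1}" SL2C by (rule normal_center_SL2C)
  have mult: "to_PSL2C M \<otimes>\<^bsub>PSL2C\<^esub> to_PSL2C N = to_PSL2C (M ** N)"
    if "M \<in> carrier SL2C" "N \<in> carrier SL2C" for M N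
    using rcos_sum[OF that] by (simp add: to_PSL2C_def PSL2C_def FactGroup_def) (simp add: SL2C_def)
  have closed: "to_PSL2C M \<in> carrier PSL2C" if "M \<in> carrier SL2C" for M
    using that by (auto simp: to_PSL2C_def PSL2C_def FactGroup_def RCOSETS_def)
  have W: "?W \<in> carrier SL2C" and V: "?V \<in> carrier SL2C"
    by (simp_all add: SL2C_def det_2)
  have x: "rho x \<in> carrier SL2C"
    using rho_hom assms(2) by (auto simp: hom_def)
  have "?V ** ?W = mat 1"
    by (simp add: vec_eq_iff forall_2 matrix_matrix_mult_def sum_2 mat_def)
  then have "to_PSL2C ?V \<otimes>\<^bsub>PSL2C\<^esub> flip = \<one>\<^bsub>PSL2C\<^esub>"
    unfolding flip_def mult[OF V W]
    by (simp add: to_PSL2C_eq PSL2C_def FactGroup_def)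
  then have "inv\<^bsub>PSL2C\<^esub> flip = to_PSL2C ?V"
    using group.inv_equality[OF group_PSL2C] closed[OF V] closed[OF W] by (simp add: flip_def)
  moreover have "?W ** rho x ** ?V = vector [vector [s, - r], vector [- q, p]]"
    by (simp add: assms(1) vec_eq_iff forall_2 matrix_matrix_mult_def sum_2)
  moreover have "?W ** rho x \<in> carrier SL2C"
    using m_closed[OF W x] by (simp add: SL2C_def)
  ultimately show ?thesis
    by (simp add: rho'_inf_def rho'_def flip_def mult W V x)
qed

lemma rho'_inf_a:
  "psl_act (rho'_inf (word_class trefoil_relators [(Gen_a, True)])) (Some (cis (pi / 3) * z)) = Some z"
proof -
  have "word_class trefoil_relators [(Gen_a, True)] \<in> carrier trefoil_group"
    by (simp add: trefoil_group_def presented_group_def)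
  note * = rho'_inf_eq[OF rho_generator[of Gen_a, unfolded rho_gen.simps] this]
  show ?thesis
    unfolding * psl_act_to_PSL2C
    by (simp add: moebius_def complex_eq_iff cos_60 sin_60 Re_divide Im_divide power2_eq_square field_simps)
qed

lemma rho'_inf_b:
  "psl_act (rho'_inf (word_class trefoil_relators [(Gen_b, True)]))
     (Some (cis (pi / 3) * z + cis (pi / 6))) = Some z"
proof -
  have "word_class trefoil_relators [(Gen_b, True)] \<in> carrier trefoil_group"
    by (simp add: trefoil_group_def presented_group_def)
  note * = rho'_inf_eq[OF rho_generator[of Gen_b, unfolded rho_gen.simps] this]
  show ?thesis
    unfolding * psl_act_to_PSL2C
    by (simp add: moebius_def complex_eq_iff cos_60 sin_60 cos_30 sin_30 Re_divide Im_divide power2_eq_square field_simps)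
qed


section \<open>Holonomy groups of spherical Euclidean orbifolds\<close>

definition orientation_preserving_isometry :: "(complex \<Rightarrow> complex) \<Rightarrow> bool" where
  "orientation_preserving_isometry f \<longleftrightarrow> (\<exists>u v. cmod u = 1 \<and> f = (\<lambda>z. u * z + v))"

definition properly_discontinuous ::
    "('g, 'm) monoid_scheme \<Rightarrow> ('g \<Rightarrow> 'a::topological_space \<Rightarrow> 'a) \<Rightarrow> bool" where
  "properly_discontinuous G \<phi> \<longleftrightarrow>
    (\<forall>K. compact K \<longrightarrow> finite {g \<in> carrier G. \<phi> g ` K \<inter> K \<noteq> {}})"

text \<open>The set of orbits with the quotient topology.\<close>

definition orbit_space ::
    "('g, 'm) monoid_scheme \<Rightarrow> ('g \<Rightarrow> 'a::topological_space \<Rightarrow> 'a) \<Rightarrow> 'a set topology" where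
  "orbit_space G \<phi> = topology (\<lambda>U. U \<subseteq> orbits G UNIV \<phi> \<and> open {z. orbit G \<phi> z \<in> U})"

text \<open>
  \<open>ns\<close> lists the orders of the cone points of the quotient, that is, the orders of the nontrivial
  stabilizers, one for each orbit of points with nontrivial stabilizer.
\<close>

definition has_cone_orders ::
    "('g, 'm) monoid_scheme \<Rightarrow> ('g \<Rightarrow> 'a \<Rightarrow> 'a) \<Rightarrow> nat list \<Rightarrow> bool" where
  "has_cone_orders G \<phi> ns \<longleftrightarrow>
    (\<exists>ps. distinct (map (orbit G \<phi>) ps) \<and>
      map (\<lambda>p. card (stabilizer G \<phi> p)) ps = ns \<and>
      {z. stabilizer G \<phi> z \<noteq> {\<one>\<^bsub>G\<^esub>}} = (\<Union>p\<in>set ps. orbit G \<phi> p))"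

text \<open>
  \<open>G\<close> acts on the plane through \<open>\<phi>\<close> as the holonomy of a Euclidean orbifold \<open>\<complex>/G\<close> with underlying
  space the 2-sphere and cone points of orders \<open>ns\<close>. Finite stabilizers of orientation-preserving
  isometries are cyclic groups of rotations, so every point of \<open>\<complex>/G\<close> with nontrivial stabilizer
  is a cone point.
\<close>

definition acts_as_sphere_orbifold_holonomy ::
    "('g, 'm) monoid_scheme \<Rightarrow> ('g \<Rightarrow> complex \<Rightarrow> complex) \<Rightarrow> nat list \<Rightarrow> bool" where
  "acts_as_sphere_orbifold_holonomy G \<phi> ns \<longleftrightarrow>
    faithful_action G UNIV \<phi> \<and>
    (\<forall>g\<in>carrier G. orientation_preserving_isometry (\<phi> g)) \<and>
    properly_discontinuous G \<phi> \<and>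
    orbit_space G \<phi> homeomorphic_space top_of_set (sphere (0 :: real^3) 1) \<and>
    has_cone_orders G \<phi> ns"

lemma openin_orbit_space:
  "openin (orbit_space G \<phi>) U \<longleftrightarrow> U \<subseteq> orbits G UNIV \<phi> \<and> open {z. orbit G \<phi> z \<in> U}"
proof -
  have "istopology (\<lambda>U. U \<subseteq> orbits G UNIV \<phi> \<and> open {z. orbit G \<phi> z \<in> U})"
    unfolding istopology_def
  proof (intro conjI allI impI)
    fix S T
    assume "S \<subseteq> orbits G UNIV \<phi> \<and> open {z. orbit G \<phi> z \<in> S}"
      "T \<subseteq> orbits G UNIV \<phi> \<and> open {z. orbit G \<phi> z \<in> T}"
    then show "S \<inter> T \<subseteq> orbits G UNIV \<phi>" "open {z. orbit G \<phi> z \<in> S \<inter> T}"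
      by (auto simp: Collect_conj_eq)
  next
    fix \<K>
    assume *: "\<forall>K\<in>\<K>. K \<subseteq> orbits G UNIV \<phi> \<and> open {z. orbit G \<phi> z \<in> K}"
    then show "\<Union>\<K> \<subseteq> orbits G UNIV \<phi>" by auto
    have "{z. orbit G \<phi> z \<in> \<Union>\<K>} = (\<Union>K\<in>\<K>. {z. orbit G \<phi> z \<in> K})" by auto
    then show "open {z. orbit G \<phi> z \<in> \<Union>\<K>}" using * by auto
  qed
  then show ?thesis by (simp add: orbit_space_def)
qed

end

theory Submission
  imports Defs
begin

text \<open>
  In the coordinates \<open>hex x y = \<i> (x + y \<omega>)\<close> with \<open>\<omega> = cis (\<pi>/3)\<close> multiplication by \<open>\<omega>\<close> is the integer
  linear map \<open>(x, y) \<mapsto> (- y, x + y)\<close>, and the two generators act as \<open>\<omega>\<^sup>5 z\<close> and \<open>\<omega>\<^sup>5 z + hex 0 1\<close>.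
  Hence the image is the group of all \<open>z \<mapsto> \<omega>\<^sup>k z + hex m n\<close> with integers \<open>m, n\<close>. Together with the
  reflection \<open>hex x y \<mapsto> hex (x + y) (- y)\<close> it generates the reflection group of the triangle with
  vertices \<open>hex 0 0\<close>, \<open>hex (1/2) 0\<close>, \<open>hex (1/3) (1/3)\<close>. So the orbit space is the double of this
  triangle along its boundary, which is the boundary of a convex body in 3-space, and the points
  with nontrivial stabilizer are the orbits of the three vertices.
\<close>

section \<open>The wallpaper group p6 and its fundamental chamber\<close>

text \<open>The factor \<open>\<i>\<close> turns the Eisenstein lattice so that the fixed point
  \<open>\<i>\<close> and the translation part \<open>\<i> * cis (pi / 3)\<close> of the second
  generator become integer points.\<close>

definition hex :: "real \<Rightarrow> real \<Rightarrow> complex" where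
  "hex x y = \<i> * (of_real x + of_real y * cis (pi / 3))"

text \<open>A natural exponent lets rotations compose by adding exponents. The price is that
  \<open>k\<close> is determined only modulo 6; \<open>p6E\<close> normalises it to
  \<open>k < 6\<close>, where \<open>p6_map_inj\<close> applies.\<close>

definition p6_map :: "nat \<Rightarrow> int \<Rightarrow> int \<Rightarrow> complex \<Rightarrow> complex" where
  "p6_map k m n z = cis (pi / 3) ^ k * z + hex (of_int m) (of_int n)"

definition p6 :: "(complex \<Rightarrow> complex) set" where
  "p6 = {p6_map k m n | k m n. True}"

definition p6_orbit :: "complex \<Rightarrow> complex set" where
  "p6_orbit z = {f z | f. f \<in> p6}"

text \<open>In these skew coordinates the angles at (0, 0), (1/2, 0) and (1/3, 1/3) are pi/6, pi/2
  and pi/3.\<close>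

definition chamber :: "real \<Rightarrow> real \<Rightarrow> bool" where
  "chamber x y \<longleftrightarrow> 0 \<le> y \<and> y \<le> x \<and> 2 * x + y \<le> 1"

lemma hex_Complex: "hex x y = Complex (- (sqrt 3 / 2 * y)) (x + y / 2)"
  by (simp add: hex_def complex_eq_iff cos_60 sin_60)

lemma hex_eq_iff [simp]: "hex x y = hex x' y' \<longleftrightarrow> x = x' \<and> y = y'"
  by (auto simp: hex_Complex)

lemma hex_cases: obtains x y where "z = hex x y"
proof
  show "z = hex (Im z + Re z / sqrt 3) (- 2 * Re z / sqrt 3)"
    by (simp add: hex_Complex complex_eq_iff)
qed

lemma hex_0 [simp]: "hex 0 0 = 0"
  by (simp add: hex_def)

lemma hex_add: "hex x y + hex x' y' = hex (x + x') (y + y')"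
  by (simp add: hex_def algebra_simps)

lemma hex_minus: "- hex x y = hex (- x) (- y)"
  by (simp add: hex_def algebra_simps)

lemma cis_60_hex: "cis (pi / 3) * hex x y = hex (- y) (x + y)"
  by (simp add: hex_Complex complex_eq_iff cos_60 sin_60 algebra_simps power2_eq_square[symmetric])

lemma cis_60_power6: "cis (pi / 3) ^ 6 = 1"
proof -
  have "cis (pi / 3) ^ 6 = cis (real 6 * (pi / 3))"
    by (rule Complex.DeMoivre)
  then show ?thesis by simp
qed

lemma cis_60_power_mod: "cis (pi / 3) ^ (k mod 6) = cis (pi / 3) ^ k"
proof -
  have "cis (pi / 3) ^ k = cis (pi / 3) ^ (6 * (k div 6) + k mod 6)"
    by simp
  also have "\<dots> = cis (pi / 3) ^ (k mod 6)"
    by (simp only: power_add power_mult cis_60_power6 power_one mult_1)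
  finally show ?thesis by simp
qed

lemma less_6_cases:
  assumes "k < (6::nat)"
  obtains "k = 0" | "k = 1" | "k = 2" | "k = 3" | "k = 4" | "k = 5"
  using assms by linarith

text \<open>With the six rotations written as integer matrices, fixed points and coincidences in
  orbits become questions of linear arithmetic.\<close>

lemma p6_map_hex:
  "p6_map 0 m n (hex x y) = hex (x + m) (y + n)"
  "p6_map 1 m n (hex x y) = hex (m - y) (x + y + n)"
  "p6_map 2 m n (hex x y) = hex (m - x - y) (x + n)"
  "p6_map 3 m n (hex x y) = hex (m - x) (n - y)"
  "p6_map 4 m n (hex x y) = hex (y + m) (n - x - y)"
  "p6_map 5 m n (hex x y) = hex (x + y + m) (n - x)"
  by (simp_all add: p6_map_def eval_nat_numeral mult.assoc cis_60_hex hex_add)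

lemma p6_map_mod: "p6_map (k mod 6) m n = p6_map k m n"
  by (simp add: p6_map_def fun_eq_iff cis_60_power_mod)

lemma p6E:
  assumes "f \<in> p6"
  obtains k m n where "k < 6" "f = p6_map k m n"
proof -
  obtain k m n where "f = p6_map k m n"
    using assms by (auto simp: p6_def)
  then have "f = p6_map (k mod 6) m n"
    by (simp add: p6_map_mod)
  then show thesis
    by (intro that[of "k mod 6"]) auto
qed

lemma p6_map_in_p6 [simp]: "p6_map k m n \<in> p6"
  by (auto simp: p6_def)

lemma p6_map_inj:
  assumes "p6_map k m n = p6_map k' m' n'" "k < 6" "k' < 6"
  shows "k = k' \<and> m = m' \<and> n = n'"
proof -
  have "p6_map k m n (hex x y) = p6_map k' m' n' (hex x y)" for x y
    by (simp add: assms)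
  \<comment> \<open>The images of these two points differ by \<open>hex 1 0\<close> rotated
    \<open>k\<close> times, which determines \<open>k < 6\<close>; either image then gives
    \<open>m\<close> and \<open>n\<close>.\<close>
  from this[of 1 1] this[of 2 1] show ?thesis
    using assms(2,3) by (elim less_6_cases) (simp_all add: p6_map_hex del: One_nat_def)
qed

text \<open>The lattice is stable under the rotations, so translation parts of composites and
  inverses stay integral.\<close>

lemma cis_60_power_hex_int: "\<exists>(m' :: int) (n' :: int). cis (pi / 3) ^ k * hex (of_int m) (of_int n) = hex m' n'"
proof (induction k)
  case (Suc k)
  then obtain m' n' :: int where "cis (pi / 3) ^ k * hex (of_int m) (of_int n) = hex m' n'"
    by blast
  then have "cis (pi / 3) ^ Suc k * hex (of_int m) (of_int n) = hex (of_int (- n')) (of_int (m' + n'))"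
    by (simp add: mult.assoc cis_60_hex)
  then show ?case by blast
qed auto

section \<open>Group structure and orbits of p6\<close>

lemma id_in_p6: "(\<lambda>z. z) \<in> p6"
proof -
  have "p6_map 0 0 0 = (\<lambda>z. z)"
    by (simp add: p6_map_def fun_eq_iff)
  then show ?thesis by (metis p6_map_in_p6)
qed

lemma p6_comp:
  assumes "f \<in> p6" "g \<in> p6"
  shows "(\<lambda>z. f (g z)) \<in> p6"
proof -
  obtain k m n k' m' n' where f: "f = p6_map k m n" and g: "g = p6_map k' m' n'"
    using assms by (auto simp: p6_def)
  obtain m'' n'' :: int where "cis (pi / 3) ^ k * hex (of_int m') (of_int n') = hex m'' n''"
    using cis_60_power_hex_int by blast
  then have "(\<lambda>z. f (g z)) = p6_map (k + k') (m'' + m) (n'' + n)"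
    by (simp add: fun_eq_iff f g p6_map_def power_add algebra_simps hex_add)
  then show ?thesis by simp
qed

lemma p6_inverse:
  assumes "f \<in> p6"
  shows "\<exists>g\<in>p6. \<forall>z. g (f z) = z \<and> f (g z) = z"
proof -
  obtain k m n where f: "f = p6_map k m n"
    using assms by (auto simp: p6_def)
  \<comment> \<open>The inverse rotation needs a natural exponent; \<open>5 * k\<close> works
    because the sixth power is 1.\<close>
  obtain m' n' :: int where *: "cis (pi / 3) ^ (5 * k) * hex (of_int m) (of_int n) = hex m' n'"
    using cis_60_power_hex_int by blast
  have "cis (pi / 3) ^ k * cis (pi / 3) ^ (5 * k) = (cis (pi / 3) ^ 6) ^ k"
    by (simp flip: power_add power_mult)
  then have inv: "cis (pi / 3) ^ k * cis (pi / 3) ^ (5 * k) = 1"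
    by (simp only: cis_60_power6 power_one)
  then have inv': "cis (pi / 3) ^ (5 * k) * cis (pi / 3) ^ k = 1"
    by (simp only: mult.commute)
  have **: "cis (pi / 3) ^ k * hex m' n' = hex m n"
    unfolding *[symmetric] using inv by (simp flip: mult.assoc)
  have "p6_map (5 * k) (- m') (- n') (f z) = z" for z
    using inv' by (simp add: f p6_map_def distrib_left * flip: mult.assoc hex_minus)
  moreover have "f (p6_map (5 * k) (- m') (- n') z) = z" for z
    using inv by (simp add: f p6_map_def right_diff_distrib ** flip: mult.assoc hex_minus)
  ultimately show ?thesis
    using p6_map_in_p6 by blast
qed

lemma mem_p6_orbit_refl: "z \<in> p6_orbit z"
  using id_in_p6 by (auto simp: p6_orbit_def)

lemma p6_orbit_apply:
  assumes "f \<in> p6"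
  shows "p6_orbit (f z) = p6_orbit z"
proof
  show "p6_orbit (f z) \<subseteq> p6_orbit z"
    using p6_comp[OF _ assms] by (auto simp: p6_orbit_def)
  obtain g where g: "g \<in> p6" "\<And>z. g (f z) = z"
    using p6_inverse[OF assms] by auto
  show "p6_orbit z \<subseteq> p6_orbit (f z)"
  proof
    fix w assume "w \<in> p6_orbit z"
    then obtain h where h: "h \<in> p6" "w = h (g (f z))"
      by (auto simp: p6_orbit_def g(2))
    then show "w \<in> p6_orbit (f z)"
      using p6_comp[OF h(1) g(1)] by (auto simp: p6_orbit_def)
  qed
qed

lemma p6_orbit_eq_iff: "p6_orbit z = p6_orbit w \<longleftrightarrow> (\<exists>f\<in>p6. f z = w)"
proof
  assume "p6_orbit z = p6_orbit w"
  then have "w \<in> p6_orbit z"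
    using mem_p6_orbit_refl by blast
  then show "\<exists>f\<in>p6. f z = w"
    by (auto simp: p6_orbit_def)
next
  assume "\<exists>f\<in>p6. f z = w"
  then show "p6_orbit z = p6_orbit w"
    using p6_orbit_apply by blast
qed

section \<open>The triangle and its mirror image as a fundamental domain\<close>

lemma int_cases_below_2:
  assumes "\<bar>real_of_int m\<bar> < 2"
  obtains "m = - 1" | "m = 0" | "m = 1"
  using assms by linarith

text \<open>Chamber coordinates lie in [0, 1/2], which confines \<open>m\<close> and
  \<open>n\<close> to {-1, 0, 1}. Linear arithmetic settles the 54 remaining maps. Besides
  separating orbits, the result shows that only the vertices can have nontrivial stabilizer.\<close>

lemma p6_chamber:
  assumes "f \<in> p6" "f (hex x y) = hex x' y'" "chamber x y" "chamber x' y'"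
  shows "x = x' \<and> y = y' \<and> (f = (\<lambda>z. z) \<or> (x, y) \<in> {(1/2, 0), (1/3, 1/3), (0, 0)})"
proof -
  obtain k m n where k: "k < 6" and f: "f = p6_map k m n"
    using assms(1) by (rule p6E)
  have id: "(\<lambda>z. z) = p6_map 0 0 0"
    by (simp add: p6_map_def fun_eq_iff)
  have "\<bar>real_of_int m\<bar> < 2" "\<bar>real_of_int n\<bar> < 2"
    using k assms(2-4) unfolding f chamber_def
    by (elim less_6_cases; simp add: p6_map_hex del: One_nat_def)+
  then show ?thesis
    using k assms(2-4) unfolding f chamber_def id
    by (elim less_6_cases int_cases_below_2; simp add: p6_map_hex del: One_nat_def; linarith?)
qed

text \<open>The mirror triangle across the edge \<open>y = 0\<close> is the other half of a
  fundamental domain. The same finite check shows that the two halves are identified only along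
  their boundaries, each point with its own mirror image.\<close>

lemma p6_chamber_reflect:
  assumes "f \<in> p6" "f (hex x y) = hex (x' + y') (- y')" "chamber x y" "chamber x' y'"
  shows "x = x' \<and> y = y' \<and> (y = 0 \<or> x = y \<or> 2 * x + y = 1)"
proof -
  obtain k m n where k: "k < 6" and f: "f = p6_map k m n"
    using assms(1) by (rule p6E)
  have "\<bar>real_of_int m\<bar> < 2" "\<bar>real_of_int n\<bar> < 2"
    using k assms(2-4) unfolding f chamber_def
    by (elim less_6_cases; simp add: p6_map_hex del: One_nat_def)+
  then show ?thesis
    using k assms(2-4) unfolding f chamber_def
    by (elim less_6_cases int_cases_below_2; simp add: p6_map_hex del: One_nat_def; linarith?)
qed

lemma p6_orbit_map: "p6_orbit (p6_map k m n z) = p6_orbit z"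
  by (simp add: p6_orbit_apply)

text \<open>The plane is folded step by step: translations reach the unit parallelogram, a half-turn
  halves it, rotations of order 3 cut it to a third, and the rest is the chamber together with a
  rotated copy of its mirror image.\<close>

lemma chamber_exhausts:
  "\<exists>x y. chamber x y \<and> (p6_orbit z = p6_orbit (hex x y) \<or> p6_orbit z = p6_orbit (hex (x + y) (- y)))"
proof -
  obtain x y where z: "z = hex x y" by (rule hex_cases)
  have 1: "p6_orbit z = p6_orbit (hex (frac x) (frac y))"
    using p6_orbit_map[of 0 "- \<lfloor>x\<rfloor>" "- \<lfloor>y\<rfloor>" "hex x y"] by (simp add: z p6_map_hex frac_def)
  have 2: "\<exists>x' y'. p6_orbit (hex x y) = p6_orbit (hex x' y') \<and> 0 \<le> x' \<and> 0 \<le> y' \<and> x' + y' \<le> 1"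
    if "0 \<le> x" "x \<le> 1" "0 \<le> y" "y \<le> 1" for x y
  proof (cases "x + y \<le> 1")
    case False
    \<comment> \<open>The half-turn about \<open>hex (1/2) (1/2)\<close> exchanges the two halves of
      the parallelogram.\<close>
    have "p6_orbit (hex x y) = p6_orbit (hex (1 - x) (1 - y))"
      using p6_orbit_map[of 3 1 1 "hex x y"] by (simp add: p6_map_hex)
    with that False show ?thesis by fastforce
  qed (use that in blast)
  \<comment> \<open>The rotations about \<open>hex (1/3) (1/3)\<close> permute the barycentric
    coordinates \<open>x\<close>, \<open>y\<close>, \<open>1 - x - y\<close> cyclically, so the last
    one can be made the largest.\<close>
  have 3: "\<exists>x' y'. p6_orbit (hex x y) = p6_orbit (hex x' y') \<and> 0 \<le> x' \<and> 0 \<le> y' \<and>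
      2 * x' + y' \<le> 1 \<and> x' + 2 * y' \<le> 1"
    if "0 \<le> x" "0 \<le> y" "x + y \<le> 1" for x y
  proof -
    have rot2: "p6_orbit (hex x y) = p6_orbit (hex (1 - x - y) x)"
      using p6_orbit_map[of 2 1 0 "hex x y"] by (simp add: p6_map_hex)
    have rot4: "p6_orbit (hex x y) = p6_orbit (hex y (1 - x - y))"
      using p6_orbit_map[of 4 0 1 "hex x y"] by (simp add: p6_map_hex)
    consider "2 * x + y \<le> 1" "x + 2 * y \<le> 1" | "x \<ge> y" "2 * x + y \<ge> 1" | "y \<ge> x" "x + 2 * y \<ge> 1"
      by linarith
    then show ?thesis
    proof cases
      case 1 then show ?thesis using that by blast
    next
      case 2 show ?thesis
        by (intro exI conjI, rule rot4) (use 2 that in auto)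
    next
      case 3 show ?thesis
        by (intro exI conjI, rule rot2) (use 3 that in auto)
    qed
  qed
  \<comment> \<open>The line \<open>x = y\<close> cuts the remaining kite in two. The half beyond it
    is the mirror triangle turned by pi/3 about 0.\<close>
  have 4: "\<exists>x' y'. chamber x' y' \<and>
      (p6_orbit (hex x y) = p6_orbit (hex x' y') \<or> p6_orbit (hex x y) = p6_orbit (hex (x' + y') (- y')))"
    if "0 \<le> x" "0 \<le> y" "2 * x + y \<le> 1" "x + 2 * y \<le> 1" for x y
  proof (cases "y \<le> x")
    case True
    then have "chamber x y" using that by (simp add: chamber_def)
    then show ?thesis by blast
  next
    case False
    then have "chamber y x" using that by (simp add: chamber_def)
    moreover have "p6_orbit (hex x y) = p6_orbit (hex (y + x) (- x))"
      using p6_orbit_map[of 1 0 0 "hex (y + x) (- x)"] by (simp add: p6_map_hex[unfolded One_nat_def])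
    ultimately show ?thesis by blast
  qed
  have "0 \<le> frac x" "frac x \<le> 1" "0 \<le> frac y" "frac y \<le> 1"
    by (simp_all add: less_imp_le frac_lt_1)
  from 2[OF this] obtain x1 y1 where
    a: "p6_orbit (hex (frac x) (frac y)) = p6_orbit (hex x1 y1)" "0 \<le> x1" "0 \<le> y1" "x1 + y1 \<le> 1"
    by blast
  from 3[OF a(2-4)] obtain x2 y2 where
    b: "p6_orbit (hex x1 y1) = p6_orbit (hex x2 y2)" "0 \<le> x2" "0 \<le> y2" "2 * x2 + y2 \<le> 1" "x2 + 2 * y2 \<le> 1"
    by blast
  from 4[OF b(2-5)] show ?thesis
    by (simp only: 1 a(1) b(1))
qed

text \<open>The edge \<open>y = 0\<close> is fixed by the reflection. On another edge, the
  reflection in \<open>y = 0\<close> agrees with its composite after the reflection in that edge, a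
  rotation about the common vertex: by pi/3 about 0, or a half-turn about
  \<open>hex (1/2) 0\<close>.\<close>

lemma p6_orbit_reflect_boundary:
  assumes "y = 0 \<or> x = y \<or> 2 * x + y = 1"
  shows "p6_orbit (hex (x + y) (- y)) = p6_orbit (hex x y)"
proof -
  consider "y = 0" | "x = y" | "y = 1 - 2 * x"
    using assms by linarith
  then show ?thesis
  proof cases
    case 2
    then show ?thesis
      using p6_orbit_map[of 1 0 0 "hex (x + y) (- y)"] by (simp add: p6_map_hex[unfolded One_nat_def])
  next
    case 3
    then show ?thesis
      using p6_orbit_map[of 3 1 0 "hex (x + y) (- y)"] by (simp add: p6_map_hex)
  qed simp
qed

lemma chamber_orbit_inj:
  assumes "p6_orbit (hex x y) = p6_orbit (hex x' y')" "chamber x y" "chamber x' y'"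
  shows "x = x' \<and> y = y'"
proof -
  obtain f where "f \<in> p6" "f (hex x y) = hex x' y'"
    using assms(1) unfolding p6_orbit_eq_iff by auto
  from p6_chamber[OF this assms(2,3)] show ?thesis by simp
qed

text \<open>The finite check of \<open>p6_chamber\<close>, repeated for the mirror triangle, since
  no element of p6 is a reflection that would carry the result over.\<close>

lemma p6_chamber_mirror:
  assumes "f \<in> p6" "f (hex (x + y) (- y)) = hex (x' + y') (- y')" "chamber x y" "chamber x' y'"
  shows "x = x' \<and> y = y' \<and> (f = (\<lambda>z. z) \<or> (x, y) \<in> {(1/2, 0), (1/3, 1/3), (0, 0)})"
proof -
  obtain k m n where k: "k < 6" and f: "f = p6_map k m n"
    using assms(1) by (rule p6E)
  have id: "(\<lambda>z. z) = p6_map 0 0 0"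
    by (simp add: p6_map_def fun_eq_iff)
  have "\<bar>real_of_int m\<bar> < 2" "\<bar>real_of_int n\<bar> < 2"
    using k assms(2-4) unfolding f chamber_def
    by (elim less_6_cases; simp add: p6_map_hex del: One_nat_def)+
  then show ?thesis
    using k assms(2-4) unfolding f chamber_def id
    by (elim less_6_cases int_cases_below_2; simp add: p6_map_hex del: One_nat_def; linarith?)
qed

lemma chamber_orbit_inj_mirror:
  assumes "p6_orbit (hex (x + y) (- y)) = p6_orbit (hex (x' + y') (- y'))" "chamber x y" "chamber x' y'"
  shows "x = x' \<and> y = y'"
proof -
  obtain f where "f \<in> p6" "f (hex (x + y) (- y)) = hex (x' + y') (- y')"
    using assms(1) unfolding p6_orbit_eq_iff by auto
  from p6_chamber_mirror[OF this assms(2,3)] show ?thesis by simp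
qed

lemma chamber_orbit_reflect:
  assumes "p6_orbit (hex x y) = p6_orbit (hex (x' + y') (- y'))" "chamber x y" "chamber x' y'"
  shows "x = x' \<and> y = y' \<and> (y = 0 \<or> x = y \<or> 2 * x + y = 1)"
proof -
  obtain f where "f \<in> p6" "f (hex x y) = hex (x' + y') (- y')"
    using assms(1) unfolding p6_orbit_eq_iff by auto
  from p6_chamber_reflect[OF this assms(2,3)] show ?thesis .
qed

section \<open>Discreteness of the action\<close>

lemma norm_hex_ge: "\<bar>x\<bar> \<le> 2 * norm (hex x y)" "\<bar>y\<bar> \<le> 2 * norm (hex x y)"
proof -
  have *: "\<bar>sqrt 3 / 2 * y\<bar> \<le> norm (hex x y)" "\<bar>x + y / 2\<bar> \<le> norm (hex x y)"
    using abs_Re_le_cmod[of "hex x y"] abs_Im_le_cmod[of "hex x y"] by (simp_all add: hex_Complex)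
  have "1 / 2 * \<bar>y\<bar> \<le> sqrt 3 / 2 * \<bar>y\<bar>"
    by (intro mult_right_mono) auto
  then show "\<bar>y\<bar> \<le> 2 * norm (hex x y)"
    using *(1) by (simp add: abs_mult)
  then show "\<bar>x\<bar> \<le> 2 * norm (hex x y)"
    using *(2) by linarith
qed

lemma finite_p6_meeting_bounded:
  assumes "bounded K"
  shows "finite {f \<in> p6. f ` K \<inter> K \<noteq> {}}"
proof -
  obtain R where R: "\<And>z. z \<in> K \<Longrightarrow> norm z \<le> R"
    using assms by (auto simp: bounded_iff)
  \<comment> \<open>The translation part \<open>f z - cis (pi / 3) ^ k * z\<close> has norm at most
    \<open>2 * R\<close>; \<open>norm_hex_ge\<close> doubles this bound for the coordinates.\<close>
  define N where "N = \<lceil>4 * R\<rceil>"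
  have "f \<in> (\<lambda>(k, m, n). p6_map k m n) ` ({..<6} \<times> {- N..N} \<times> {- N..N})"
    if f: "f \<in> p6" and z: "z \<in> K" "f z \<in> K" for f z
  proof -
    obtain k m n where k: "k < 6" "f = p6_map k m n"
      using f by (rule p6E)
    have "hex m n = f z - cis (pi / 3) ^ k * z"
      by (simp add: k p6_map_def)
    then have "norm (hex m n) \<le> norm (f z) + norm (cis (pi / 3) ^ k * z)"
      by (metis norm_triangle_ineq4)
    also have "\<dots> \<le> R + R"
      using R[OF z(1)] R[OF z(2)] by (simp add: norm_mult norm_power)
    finally have "\<bar>real_of_int m\<bar> \<le> 4 * R" "\<bar>real_of_int n\<bar> \<le> 4 * R"
      using norm_hex_ge(1)[of m n] norm_hex_ge(2)[where x = m and y = n] by linarith+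
    then have "\<bar>m\<bar> \<le> N" "\<bar>n\<bar> \<le> N"
      unfolding N_def by linarith+
    then show ?thesis
      using k by (intro image_eqI[of _ _ "(k, m, n)"]) auto
  qed
  then have "{f \<in> p6. f ` K \<inter> K \<noteq> {}} \<subseteq> (\<lambda>(k, m, n). p6_map k m n) ` ({..<6} \<times> {- N..N} \<times> {- N..N})"
    by blast
  then show ?thesis
    by (rule finite_subset) auto
qed

lemma p6_isometry:
  assumes "f \<in> p6"
  shows "dist (f z) (f w) = dist z w"
proof -
  obtain k m n where "f = p6_map k m n"
    using assms by (rule p6E)
  then have "f z - f w = cis (pi / 3) ^ k * (z - w)"
    by (simp add: p6_map_def algebra_simps)
  then show ?thesis
    by (simp add: dist_norm norm_mult norm_power)
qed

section \<open>The orbit space\<close>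

text \<open>The quotient depends on the acting group only through its image, so the topology can be
  studied for p6 alone.\<close>

lemma orbit_eq_p6_orbit:
  assumes "\<phi> ` carrier G = p6"
  shows "orbit G \<phi> z = p6_orbit z"
  unfolding orbit_def p6_orbit_def assms[symmetric] by auto

lemma openin_orbit_space_p6:
  assumes "\<phi> ` carrier G = p6"
  shows "openin (orbit_space G \<phi>) U \<longleftrightarrow> U \<subseteq> range p6_orbit \<and> open {z. p6_orbit z \<in> U}"
  unfolding openin_orbit_space orbits_def orbit_eq_p6_orbit[OF assms] by (simp add: full_SetCompr_eq)

lemma topspace_orbit_space_p6:
  assumes "\<phi> ` carrier G = p6"
  shows "topspace (orbit_space G \<phi>) = range p6_orbit"
proof
  show "topspace (orbit_space G \<phi>) \<subseteq> range p6_orbit"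
    using openin_topspace[of "orbit_space G \<phi>"] unfolding openin_orbit_space_p6[OF assms] by blast
  have "openin (orbit_space G \<phi>) (range p6_orbit)"
    unfolding openin_orbit_space_p6[OF assms] by simp
  then show "range p6_orbit \<subseteq> topspace (orbit_space G \<phi>)"
    by (rule openin_subset)
qed

lemma continuous_map_p6_orbit:
  assumes "\<phi> ` carrier G = p6"
  shows "continuous_map euclidean (orbit_space G \<phi>) p6_orbit"
  unfolding continuous_map_def topspace_orbit_space_p6[OF assms] openin_orbit_space_p6[OF assms]
  by auto

lemma p6_orbit_separated:
  assumes "w \<notin> p6_orbit z"
  shows "\<exists>\<delta>>0. \<forall>f\<in>p6. \<delta> \<le> dist w (f z)"
proof -
  \<comment> \<open>Any \<open>f\<close> bringing \<open>z\<close> within distance 1 of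
    \<open>w\<close> makes \<open>?K\<close> meet its image, so only finitely many orbit points come
    that close.\<close>
  let ?K = "insert z (cball w 1)"
  have "finite {f \<in> p6. f ` ?K \<inter> ?K \<noteq> {}}"
    by (rule finite_p6_meeting_bounded) simp
  then have "finite ((\<lambda>f. f z) ` {f \<in> p6. f ` ?K \<inter> ?K \<noteq> {}})"
    by (rule finite_imageI)
  from finite_set_avoid[OF this, of w] obtain d where
    d: "d > 0" "\<forall>x \<in> (\<lambda>f. f z) ` {f \<in> p6. f ` ?K \<inter> ?K \<noteq> {}}. x \<noteq> w \<longrightarrow> d \<le> dist w x"
    by auto
  have "min d 1 \<le> dist w (f z)" if f: "f \<in> p6" for f
  proof (cases "dist w (f z) \<le> 1")
    case True
    then have "f z \<in> f ` ?K \<inter> ?K" by auto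
    moreover have "f z \<noteq> w"
      using assms f by (auto simp: p6_orbit_def)
    ultimately have "d \<le> dist w (f z)"
      using d(2) f by blast
    then show ?thesis by simp
  qed simp
  then show ?thesis
    using d(1) by (intro exI[of _ "min d 1"]) auto
qed

text \<open>If one orbit keeps distance \<open>\<delta>\<close> from a point of another, balls of
  radius \<open>\<delta> / 2\<close> have disjoint images, because the group acts by
  isometries.\<close>

lemma Hausdorff_orbit_space_p6:
  assumes "\<phi> ` carrier G = p6"
  shows "Hausdorff_space (orbit_space G \<phi>)"
  unfolding Hausdorff_space_def topspace_orbit_space_p6[OF assms]
proof (intro allI impI)
  fix C D
  assume "C \<in> range p6_orbit \<and> D \<in> range p6_orbit \<and> C \<noteq> D"
  then obtain z w where C: "C = p6_orbit z" and D: "D = p6_orbit w" and ne: "p6_orbit z \<noteq> p6_orbit w"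
    by blast
  have "w \<notin> p6_orbit z"
  proof
    assume "w \<in> p6_orbit z"
    then obtain f where f: "f \<in> p6" "w = f z"
      by (auto simp: p6_orbit_def)
    then show False
      using ne p6_orbit_apply[OF f(1), of z] by simp
  qed
  then obtain \<delta> where \<delta>: "\<delta> > 0" "\<forall>f\<in>p6. \<delta> \<le> dist w (f z)"
    using p6_orbit_separated[of w z] by auto
  define N where "N z = p6_orbit ` ball z (\<delta> / 2)" for z
  have N: "openin (orbit_space G \<phi>) (N z)" for z
  proof -
    \<comment> \<open>The saturation of a ball is the union of its translates, hence open.\<close>
    have "{u. p6_orbit u \<in> N z} = (\<Union>f\<in>p6. ball (f z) (\<delta> / 2))"
    proof (intro equalityI subsetI)
      fix u assume "u \<in> {u. p6_orbit u \<in> N z}"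
      then obtain v where v: "dist z v < \<delta> / 2" "p6_orbit v = p6_orbit u"
        by (auto simp: N_def)
      then obtain f where "f \<in> p6" "f v = u"
        by (auto simp: p6_orbit_eq_iff)
      with v show "u \<in> (\<Union>f\<in>p6. ball (f z) (\<delta> / 2))"
        using p6_isometry[of f z v] by (intro UN_I[of f]) auto
    next
      fix u assume "u \<in> (\<Union>f\<in>p6. ball (f z) (\<delta> / 2))"
      then obtain f where f: "f \<in> p6" "dist (f z) u < \<delta> / 2"
        by auto
      then obtain g where g: "g \<in> p6" "\<And>z. g (f z) = z"
        using p6_inverse[OF f(1)] by auto
      have "dist z (g u) < \<delta> / 2"
        using p6_isometry[OF g(1), of "f z" u] f(2) g(2) by simp
      then show "u \<in> {u. p6_orbit u \<in> N z}"
        using p6_orbit_apply[OF g(1), of u] by (auto simp: N_def intro!: image_eqI[of _ _ "g u"])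
    qed
    then show ?thesis
      unfolding openin_orbit_space_p6[OF assms] by (auto simp: N_def)
  qed
  have "disjnt (N z) (N w)"
  proof -
    have False if uv: "dist z u < \<delta> / 2" "dist w v < \<delta> / 2" "p6_orbit u = p6_orbit v" for u v
    proof -
      obtain f where f: "f \<in> p6" "f u = v"
        using uv(3) by (auto simp: p6_orbit_eq_iff)
      have "dist v (f z) < \<delta> / 2"
        using p6_isometry[OF f(1), of z u] uv(1) f(2) by (simp add: dist_commute)
      then have "dist w (f z) < \<delta>"
        using uv(2) dist_triangle[of w "f z" v] by simp
      then show False
        using \<delta>(2) f(1) by force
    qed
    then show ?thesis
      by (force simp: disjnt_def N_def)
  qed
  moreover have "C \<in> N z" "D \<in> N w"
    using \<delta>(1) by (auto simp: C D N_def)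
  ultimately show "\<exists>U V. openin (orbit_space G \<phi>) U \<and> openin (orbit_space G \<phi>) V \<and> C \<in> U \<and> D \<in> V \<and> disjnt U V"
    using N by blast
qed

section \<open>The double of the triangle as a sphere\<close>

text \<open>
  The minimum is concave and vanishes exactly on the boundary of the chamber, so the two graphs
  bound a convex body. The upper one is mapped to the chamber, the lower one to its mirror image.
\<close>

definition double_chamber :: "(real \<times> real \<times> real) set" where
  "double_chamber = {(x, y, s). \<bar>s\<bar> = min y (min (x - y) (1 - 2 * x - y))}"

text \<open>The body \<open>B\<close> between the two graphs is bounded, convex and has interior
  points, so its frontier is homeomorphic to that of the unit ball of the same dimension.\<close>

lemma double_chamber_homeomorphic_sphere:
  "double_chamber homeomorphic sphere (0 :: real^3) 1"
proof -
  define B :: "(real \<times> real \<times> real) set" where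
    "B = {p. \<bar>snd (snd p)\<bar> \<le> min (fst (snd p)) (min (fst p - fst (snd p)) (1 - 2 * fst p - fst (snd p)))}"
  have B: "(x, y, s) \<in> B \<longleftrightarrow> \<bar>s\<bar> \<le> y \<and> \<bar>s\<bar> \<le> x - y \<and> \<bar>s\<bar> \<le> 1 - 2 * x - y" for x y s
    by (simp add: B_def)
  have closed: "closed B"
    unfolding B_def by (intro closed_Collect_le continuous_intros)
  have "B \<subseteq> {0..1} \<times> {0..1} \<times> {- 1..1}"
    by (auto simp: B)
  then have bdd: "bounded B"
    by (rule bounded_subset[rotated]) (intro bounded_Times bounded_closed_interval)
  have "convex B"
  proof (rule convexI, clarify)
    fix x y s x' y' s' u v :: real
    assume p: "(x, y, s) \<in> B" "(x', y', s') \<in> B" and uv: "0 \<le> u" "0 \<le> v" "u + v = 1"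
    have abs: "\<bar>u * s + v * s'\<bar> \<le> u * a + v * b" if "\<bar>s\<bar> \<le> a" "\<bar>s'\<bar> \<le> b" for a b
    proof -
      have "\<bar>u * s + v * s'\<bar> \<le> u * \<bar>s\<bar> + v * \<bar>s'\<bar>"
        using abs_triangle_ineq[of "u * s" "v * s'"] uv by (simp add: abs_mult)
      also have "\<dots> \<le> u * a + v * b"
        using that uv by (intro add_mono mult_left_mono) auto
      finally show ?thesis .
    qed
    \<comment> \<open>The third bound is affine rather than linear; its constant term survives
      because the weights sum to 1.\<close>
    have v: "v = 1 - u"
      using uv(3) by simp
    have "u * (1 - 2 * x - y) + v * (1 - 2 * x' - y') = 1 - 2 * (u * x + v * x') - (u * y + v * y')"
      by (simp add: v algebra_simps)
    then show "u *\<^sub>R (x, y, s) + v *\<^sub>R (x', y', s') \<in> B"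
      using p abs[of y y'] abs[of "x - y" "x' - y'"] abs[of "1 - 2 * x - y" "1 - 2 * x' - y'"]
      by (simp add: B algebra_simps)
  qed
  define B' :: "(real \<times> real \<times> real) set" where
    "B' = {p. \<bar>snd (snd p)\<bar> < min (fst (snd p)) (min (fst p - fst (snd p)) (1 - 2 * fst p - fst (snd p)))}"
  have "open B'"
    unfolding B'_def by (intro open_Collect_less continuous_intros)
  then have B': "B' \<subseteq> interior B"
    by (rule interior_maximal[rotated]) (auto simp: B_def B'_def)
  \<comment> \<open>A point over the interior of the chamber: the three bounds there are 1/10, 1/5
    and 3/10.\<close>
  have "(3/10, 1/10, 0) \<in> B'"
    by (simp add: B'_def)
  with B' have ne: "interior B \<noteq> {}"
    by blast
  have "(x, y, s) \<notin> interior B" if "\<bar>s\<bar> = min y (min (x - y) (1 - 2 * x - y))" for x y s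
  proof
    assume "(x, y, s) \<in> interior B"
    then obtain e where e: "e > 0" "ball (x, y, s) e \<subseteq> B"
      by (auto simp: mem_interior)
    \<comment> \<open>From a point on either graph, one of the two vertical moves leaves
      \<open>B\<close>.\<close>
    have "(x, y, s + e / 2) \<in> ball (x, y, s) e" "(x, y, s - e / 2) \<in> ball (x, y, s) e"
      using e(1) by (simp_all add: dist_Pair_Pair dist_norm)
    with e(2) have "(x, y, s + e / 2) \<in> B" "(x, y, s - e / 2) \<in> B"
      by blast+
    then show False
      using that e(1) unfolding B by linarith
  qed
  then have "p \<notin> interior B" if "p \<in> double_chamber" for p
    using that by (auto simp: double_chamber_def)
  moreover have "p \<in> double_chamber \<or> p \<in> B'" if "p \<in> B" for p
    using that by (simp add: double_chamber_def B_def B'_def case_prod_unfold del: min_less_iff_conj min.bounded_iff) linarith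
  moreover have "double_chamber \<subseteq> B"
    by (auto simp: double_chamber_def B_def)
  ultimately have "frontier B = double_chamber"
    using B' unfolding frontier_def closure_closed[OF closed] by blast
  then have rel: "rel_frontier B = double_chamber"
    by (simp add: rel_frontier_nonempty_interior ne)
  have "aff_dim B = aff_dim (cball (0 :: real^3) 1)"
    by (simp add: aff_dim_nonempty_interior[OF ne] aff_dim_cball)
  then have "rel_frontier B homeomorphic rel_frontier (cball (0 :: real^3) 1)"
    by (intro homeomorphic_rel_frontiers_convex_bounded_sets \<open>convex B\<close> bdd) auto
  then show ?thesis
    by (simp add: rel)
qed

lemma compact_double_chamber: "compact double_chamber"
  using homeomorphic_compactness[OF double_chamber_homeomorphic_sphere] by simp

lemma continuous_on_hex [continuous_intros]:
  "continuous_on S f \<Longrightarrow> continuous_on S g \<Longrightarrow> continuous_on S (\<lambda>p. hex (f p) (g p))"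
  unfolding hex_def by (intro continuous_intros)

text \<open>The map \<open>h\<close> sends the two sheets of the double to the orbits of the chamber
  and of its mirror image. It is a continuous bijection from a compact space to a Hausdorff space,
  hence a homeomorphism.\<close>

lemma orbit_space_p6_homeomorphic_sphere:
  assumes "\<phi> ` carrier G = p6"
  shows "orbit_space G \<phi> homeomorphic_space top_of_set (sphere (0 :: real^3) 1)"
proof -
  let ?X = "orbit_space G \<phi>" and ?D = "top_of_set double_chamber"
  define h where "h = (\<lambda>p :: real \<times> real \<times> real. if 0 \<le> snd (snd p) then p6_orbit (hex (fst p) (fst (snd p)))
    else p6_orbit (hex (fst p + fst (snd p)) (- fst (snd p))))"
  have h: "h (x, y, s) = (if 0 \<le> s then p6_orbit (hex x y) else p6_orbit (hex (x + y) (- y)))" for x y s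
    by (simp add: h_def)
  have orb: "continuous_map (subtopology ?D S) ?X (\<lambda>p. p6_orbit (g p))" if "continuous_on UNIV g" for g S
  proof -
    have "continuous_map (subtopology ?D S) euclidean g"
      by (simp add: subtopology_subtopology continuous_on_subset[OF that])
    from continuous_map_compose[OF this continuous_map_p6_orbit[OF assms]]
    show ?thesis by (simp add: o_def)
  qed
  have "continuous_map ?D ?X h"
    unfolding h_def
  proof (rule continuous_map_cases_le)
    show "continuous_map ?D euclideanreal (\<lambda>p. snd (snd p))"
      by (simp add: continuous_intros)
    \<comment> \<open>The sheets meet at height 0, over the boundary of the chamber, where a point
      and its mirror image have the same orbit.\<close>
    fix p assume p: "p \<in> topspace ?D" "0 = snd (snd p)"
    obtain x y s where "p = (x, y, s)" by (cases p)
    then show "p6_orbit (hex (fst p) (fst (snd p))) = p6_orbit (hex (fst p + fst (snd p)) (- fst (snd p)))"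
      using p p6_orbit_reflect_boundary[of y x]
      by (force simp: double_chamber_def min_def split: if_splits)
  qed (auto intro!: orb continuous_intros)
  moreover have "compact_space ?D"
    by (simp add: compact_space_subtopology compact_double_chamber)
  moreover have "h ` topspace ?D = topspace ?X"
    unfolding topspace_orbit_space_p6[OF assms]
  proof
    show "h ` topspace ?D \<subseteq> range p6_orbit"
      by (auto simp: h_def)
    have "p6_orbit z \<in> h ` double_chamber" for z
    proof -
      obtain x y where xy: "chamber x y"
        "p6_orbit z = p6_orbit (hex x y) \<or> p6_orbit z = p6_orbit (hex (x + y) (- y))"
        using chamber_exhausts by blast
      define d where "d = min y (min (x - y) (1 - 2 * x - y))"
      have d: "0 \<le> d"
        using xy(1) by (auto simp: chamber_def d_def)
      have D: "(x, y, d) \<in> double_chamber" "(x, y, - d) \<in> double_chamber"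
        using d by (simp_all add: double_chamber_def d_def)
      have "p6_orbit (hex x y) = h (x, y, d)"
        using d by (simp add: h)
      \<comment> \<open>For \<open>d = 0\<close> the definition of \<open>h\<close> selects the
        upper branch, so the boundary identification is needed.\<close>
      moreover have "p6_orbit (hex (x + y) (- y)) = h (x, y, - d)"
      proof (cases "d = 0")
        case True
        then have "y = 0 \<or> x = y \<or> 2 * x + y = 1"
          by (auto simp: d_def min_def split: if_splits)
        then show ?thesis
          using p6_orbit_reflect_boundary True by (simp add: h)
      qed (use d in \<open>simp add: h\<close>)
      ultimately show ?thesis
        using xy(2) D by auto
    qed
    then show "range p6_orbit \<subseteq> h ` topspace ?D"
      by auto
  qed
  moreover have "inj_on h (topspace ?D)"
  proof (rule inj_onI, clarsimp)
    fix x y s x' y' s'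
    assume p: "(x, y, s) \<in> double_chamber" "(x', y', s') \<in> double_chamber"
      and eq: "h (x, y, s) = h (x', y', s')"
    have c: "chamber x y" "chamber x' y'"
      using p by (auto simp: chamber_def double_chamber_def)
    have s0: "s = 0" if "\<bar>s\<bar> = min b (min (a - b) (1 - 2 * a - b))" "chamber a b" "b = 0 \<or> a = b \<or> 2 * a + b = 1"
      for a b s :: real
      using that by (auto simp: chamber_def min_def split: if_splits)
    have s: "\<bar>s\<bar> = min y (min (x - y) (1 - 2 * x - y))" "\<bar>s'\<bar> = min y' (min (x' - y') (1 - 2 * x' - y'))"
      using p by (simp_all add: double_chamber_def)
    consider "0 \<le> s" "0 \<le> s'" | "0 \<le> s" "s' < 0" | "s < 0" "0 \<le> s'" | "s < 0" "s' < 0"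
      by linarith
    then show "x = x' \<and> y = y' \<and> s = s'"
    proof cases
      case 1
      then have "x = x' \<and> y = y'"
        using eq c chamber_orbit_inj by (simp add: h)
      then show ?thesis using s 1 by simp
    next
      \<comment> \<open>Equal orbits on different sheets force a boundary point, so both heights
        vanish, contradicting \<open>s' < 0\<close>.\<close>
      case 2
      then have "x = x' \<and> y = y' \<and> (y = 0 \<or> x = y \<or> 2 * x + y = 1)"
        using eq c by (intro chamber_orbit_reflect) (simp_all add: h)
      then show ?thesis using s s0 c by metis
    next
      case 3
      then have "x' = x \<and> y' = y \<and> (y' = 0 \<or> x' = y' \<or> 2 * x' + y' = 1)"
        using eq c by (intro chamber_orbit_reflect) (simp_all add: h)
      then show ?thesis using s s0 c by metis
    next
      case 4
      then have "p6_orbit (hex (x + y) (- y)) = p6_orbit (hex (x' + y') (- y'))"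
        using eq by (simp add: h)
      then have "x = x' \<and> y = y'"
        using c by (rule chamber_orbit_inj_mirror)
      then show ?thesis using s 4 by simp
    qed
  qed
  ultimately have "homeomorphic_map ?D ?X h"
    by (intro continuous_imp_homeomorphic_map Hausdorff_orbit_space_p6 assms)
  then have "?X homeomorphic_space ?D"
    using homeomorphic_map_imp_homeomorphic_space homeomorphic_space_sym by blast
  also have "?D homeomorphic_space top_of_set (sphere (0 :: real^3) 1)"
  proof -
    obtain f g where "homeomorphism double_chamber (sphere (0 :: real^3) 1) f g"
      using double_chamber_homeomorphic_sphere unfolding homeomorphic_def by auto
    then have "homeomorphic_maps ?D (top_of_set (sphere (0 :: real^3) 1)) f g"
      by (force simp: Pi_iff homeomorphic_maps_def homeomorphism_def)
    then show ?thesis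
      unfolding homeomorphic_space_def by auto
  qed
  finally show ?thesis .
qed

section \<open>Points with nontrivial stabilizer\<close>

definition p6_ramified :: "complex \<Rightarrow> bool" where
  "p6_ramified z \<longleftrightarrow> (\<exists>f\<in>p6. f \<noteq> (\<lambda>z. z) \<and> f z = z)"

text \<open>Conjugating by \<open>g\<close> carries the stabilizer of \<open>z\<close> to that of
  \<open>g z\<close>.\<close>

lemma p6_ramified_apply:
  assumes "p6_ramified z" "g \<in> p6"
  shows "p6_ramified (g z)"
proof -
  obtain f where f: "f \<in> p6" "f \<noteq> (\<lambda>z. z)" "f z = z"
    using assms(1) by (auto simp: p6_ramified_def)
  obtain h where h: "h \<in> p6" "\<And>u. h (g u) = u" "\<And>u. g (h u) = u"
    using p6_inverse[OF assms(2)] by auto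
  let ?f = "\<lambda>u. g (f (h u))"
  have "?f \<in> p6"
    using p6_comp[OF assms(2) p6_comp[OF f(1) h(1)]] by simp
  moreover have "?f (g z) = g z"
    by (simp add: h(2) f(3))
  moreover have "?f \<noteq> (\<lambda>z. z)"
  proof
    assume "?f = (\<lambda>z. z)"
    then have "f u = u" for u
      using fun_cong[of ?f "\<lambda>z. z" "g u"] h(2)[of "f u"] h(2)[of u] by simp
    then show False
      using f(2) by auto
  qed
  ultimately show ?thesis
    unfolding p6_ramified_def by (intro bexI[of _ ?f] conjI)
qed

lemma p6_ramified_orbit:
  assumes "p6_orbit z = p6_orbit w"
  shows "p6_ramified z \<longleftrightarrow> p6_ramified w"
proof -
  have "p6_ramified v" if uv: "p6_orbit u = p6_orbit v" and u: "p6_ramified u" for u v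
  proof -
    obtain g where "g \<in> p6" "g u = v"
      using uv by (auto simp: p6_orbit_eq_iff)
    then show ?thesis
      using p6_ramified_apply[OF u] by auto
  qed
  then show ?thesis
    using assms by metis
qed

text \<open>As in \<open>p6_chamber\<close>, the fixed-point equation bounds \<open>m\<close> and
  \<open>n\<close> and leaves finitely many maps to test.\<close>

lemma p6_fixing_half:
  "{f \<in> p6. f (hex (1/2) 0) = hex (1/2) 0} = {p6_map 0 0 0, p6_map 3 1 0}"
proof (intro equalityI subsetI)
  fix f assume f: "f \<in> {f \<in> p6. f (hex (1/2) 0) = hex (1/2) 0}"
  then obtain k m n where k: "k < 6" "f = p6_map k m n" and eq: "p6_map k m n (hex (1/2) 0) = hex (1/2) 0"
    by (auto elim: p6E)
  have "\<bar>real_of_int m\<bar> < 2" "\<bar>real_of_int n\<bar> < 2"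
    using k(1) eq by (elim less_6_cases; simp add: p6_map_hex del: One_nat_def)+
  with k(1) eq have "k = 0 \<and> m = 0 \<and> n = 0 \<or> k = 3 \<and> m = 1 \<and> n = 0"
    by (elim less_6_cases int_cases_below_2; simp add: p6_map_hex del: One_nat_def)
  then show "f \<in> {p6_map 0 0 0, p6_map 3 1 0}"
    using k(2) by auto
qed (auto simp: p6_map_hex)

lemma p6_fixing_third:
  "{f \<in> p6. f (hex (1/3) (1/3)) = hex (1/3) (1/3)} = {p6_map 0 0 0, p6_map 2 1 0, p6_map 4 0 1}"
proof (intro equalityI subsetI)
  fix f assume f: "f \<in> {f \<in> p6. f (hex (1/3) (1/3)) = hex (1/3) (1/3)}"
  then obtain k m n where k: "k < 6" "f = p6_map k m n"
    and eq: "p6_map k m n (hex (1/3) (1/3)) = hex (1/3) (1/3)"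
    by (auto elim: p6E)
  have "\<bar>real_of_int m\<bar> < 2" "\<bar>real_of_int n\<bar> < 2"
    using k(1) eq by (elim less_6_cases; simp add: p6_map_hex del: One_nat_def)+
  with k(1) eq have "k = 0 \<and> m = 0 \<and> n = 0 \<or> k = 2 \<and> m = 1 \<and> n = 0 \<or> k = 4 \<and> m = 0 \<and> n = 1"
    by (elim less_6_cases int_cases_below_2; simp add: p6_map_hex del: One_nat_def)
  then show "f \<in> {p6_map 0 0 0, p6_map 2 1 0, p6_map 4 0 1}"
    using k(2) by auto
qed (auto simp: p6_map_hex)

lemma p6_fixing_0: "{f \<in> p6. f 0 = 0} = (\<lambda>k. p6_map k 0 0) ` {..<6}"
proof (intro equalityI subsetI)
  fix f assume f: "f \<in> {f \<in> p6. f 0 = 0}"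
  then obtain k m n where k: "k < 6" "f = p6_map k m n" and eq: "p6_map k m n 0 = 0"
    by (auto elim: p6E)
  from eq have "hex m n = hex 0 0"
    by (simp add: p6_map_def)
  then have "m = 0" "n = 0"
    unfolding hex_eq_iff by simp_all
  then show "f \<in> (\<lambda>k. p6_map k 0 0) ` {..<6}"
    using k by auto
qed (auto simp: p6_map_def)

lemma card_p6_fixing:
  "card {f \<in> p6. f (hex (1/2) 0) = hex (1/2) 0} = 2"
  "card {f \<in> p6. f (hex (1/3) (1/3)) = hex (1/3) (1/3)} = 3"
  "card {f \<in> p6. f 0 = 0} = 6"
proof -
  have ne: "p6_map k m n \<noteq> p6_map k' m' n'" if "k < 6" "k' < 6" "k \<noteq> k'" for k k' m n m' n'
    using p6_map_inj that by blast
  show "card {f \<in> p6. f (hex (1/2) 0) = hex (1/2) 0} = 2"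
    unfolding p6_fixing_half by (simp add: ne)
  show "card {f \<in> p6. f (hex (1/3) (1/3)) = hex (1/3) (1/3)} = 3"
    unfolding p6_fixing_third by (simp add: ne)
  have "inj_on (\<lambda>k. p6_map k 0 0) {..<6}"
    using p6_map_inj by (intro inj_onI) simp
  then show "card {f \<in> p6. f 0 = 0} = 6"
    unfolding p6_fixing_0 by (simp add: card_image)
qed

text \<open>Every point has an orbit representative in the chamber or its mirror triangle, and there
  a nontrivial element fixes nothing but the vertices.\<close>

lemma p6_ramified_iff:
  "p6_ramified z \<longleftrightarrow> z \<in> p6_orbit (hex (1/2) 0) \<union> p6_orbit (hex (1/3) (1/3)) \<union> p6_orbit 0"
proof
  assume z: "p6_ramified z"
  obtain x y where c: "chamber x y"
    and xy: "p6_orbit z = p6_orbit (hex x y) \<or> p6_orbit z = p6_orbit (hex (x + y) (- y))"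
    using chamber_exhausts[of z] by auto
  have "(x, y) \<in> {(1/2, 0), (1/3, 1/3), (0, 0)}"
    using xy
  proof
    assume "p6_orbit z = p6_orbit (hex x y)"
    then have "p6_ramified (hex x y)"
      using z p6_ramified_orbit by blast
    then obtain f where "f \<in> p6" "f \<noteq> (\<lambda>z. z)" "f (hex x y) = hex x y"
      by (auto simp: p6_ramified_def)
    then show ?thesis
      using p6_chamber[OF _ _ c c, of f] by blast
  next
    assume "p6_orbit z = p6_orbit (hex (x + y) (- y))"
    then have "p6_ramified (hex (x + y) (- y))"
      using z p6_ramified_orbit by blast
    then obtain f where "f \<in> p6" "f \<noteq> (\<lambda>z. z)" "f (hex (x + y) (- y)) = hex (x + y) (- y)"
      by (auto simp: p6_ramified_def)
    then show ?thesis
      using p6_chamber_mirror[OF _ _ c c, of f] by blast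
  qed
  \<comment> \<open>The vertices lie on the boundary, so the mirror case reduces to the chamber
    case.\<close>
  moreover from this have "p6_orbit z = p6_orbit (hex x y)"
    using xy p6_orbit_reflect_boundary[of y x] by auto
  then have "z \<in> p6_orbit (hex x y)"
    using mem_p6_orbit_refl by blast
  ultimately show "z \<in> p6_orbit (hex (1/2) 0) \<union> p6_orbit (hex (1/3) (1/3)) \<union> p6_orbit 0"
    unfolding insert_iff prod.inject by (elim disjE conjE) (simp_all only: Un_iff hex_0, simp_all)
next
  have ram: "p6_ramified w" if "p6_map k m n w = w" "k \<in> {2, 3}" for k m n w
  proof -
    have "p6_map k m n \<noteq> p6_map 0 0 0"
      using p6_map_inj[of k m n 0 0 0] that(2) by auto
    moreover have "p6_map 0 0 0 = (\<lambda>z. z)"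
      by (simp add: p6_map_def fun_eq_iff)
    ultimately show ?thesis
      using that(1) unfolding p6_ramified_def by (intro bexI[of _ "p6_map k m n"]) auto
  qed
  have "p6_ramified (hex (1/2) 0)"
    using ram[of 3 1 0] by (simp add: p6_map_hex)
  moreover have "p6_ramified (hex (1/3) (1/3))"
    using ram[of 2 1 0] by (simp add: p6_map_hex)
  moreover have "p6_ramified 0"
    using ram[of 3 0 0] by (simp add: p6_map_def)
  moreover assume "z \<in> p6_orbit (hex (1/2) 0) \<union> p6_orbit (hex (1/3) (1/3)) \<union> p6_orbit 0"
  ultimately show "p6_ramified z"
    by (auto simp: p6_orbit_def intro: p6_ramified_apply)
qed

text \<open>Injectivity of the action identifies stabilizers in \<open>G\<close> with those in p6.
  The three vertices represent different orbits because distinct chamber points do.\<close>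

lemma p6_cone_orders:
  assumes image: "\<phi> ` carrier G = p6" and inj: "inj_on \<phi> (carrier G)"
    and one: "\<one>\<^bsub>G\<^esub> \<in> carrier G" "\<phi> \<one>\<^bsub>G\<^esub> = (\<lambda>z. z)"
  shows "has_cone_orders G \<phi> [2, 3, 6]"
proof -
  note orb = orbit_eq_p6_orbit[OF image]
  have card: "card (stabilizer G \<phi> z) = card {f \<in> p6. f z = z}" for z
  proof -
    have "\<phi> ` stabilizer G \<phi> z = {f \<in> p6. f z = z}"
      unfolding stabilizer_def image[symmetric] by auto
    moreover have "inj_on \<phi> (stabilizer G \<phi> z)"
      using inj by (rule inj_on_subset) (auto simp: stabilizer_def)
    ultimately show ?thesis
      using card_image by metis
  qed
  have "stabilizer G \<phi> z \<noteq> {\<one>\<^bsub>G\<^esub>} \<longleftrightarrow> p6_ramified z" for z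
  proof -
    have "\<one>\<^bsub>G\<^esub> \<in> stabilizer G \<phi> z"
      using one by (simp add: stabilizer_def)
    then have "stabilizer G \<phi> z \<noteq> {\<one>\<^bsub>G\<^esub>} \<longleftrightarrow> (\<exists>g \<in> stabilizer G \<phi> z. g \<noteq> \<one>\<^bsub>G\<^esub>)"
      by blast
    also have "\<dots> \<longleftrightarrow> (\<exists>g \<in> carrier G. \<phi> g z = z \<and> \<phi> g \<noteq> \<phi> \<one>\<^bsub>G\<^esub>)"
      using inj_on_eq_iff[OF inj _ one(1)] by (auto simp: stabilizer_def)
    also have "\<dots> \<longleftrightarrow> p6_ramified z"
      unfolding p6_ramified_def image[symmetric] one(2) by auto
    finally show ?thesis .
  qed
  then have ram: "{z. stabilizer G \<phi> z \<noteq> {\<one>\<^bsub>G\<^esub>}} = (\<Union>p\<in>set [hex (1/2) 0, hex (1/3) (1/3), 0]. orbit G \<phi> p)"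
    unfolding orb by (auto simp: p6_ramified_iff)
  have "p6_orbit (hex (1/2) 0) \<noteq> p6_orbit (hex (1/3) (1/3))"
    using chamber_orbit_inj[of "1/2" 0 "1/3" "1/3"] by (auto simp: chamber_def)
  moreover have "p6_orbit (hex (1/2) 0) \<noteq> p6_orbit 0"
    using chamber_orbit_inj[of "1/2" 0 0 0] by (auto simp: chamber_def)
  moreover have "p6_orbit (hex (1/3) (1/3)) \<noteq> p6_orbit 0"
    using chamber_orbit_inj[of "1/3" "1/3" 0 0] by (auto simp: chamber_def)
  ultimately have "distinct (map (orbit G \<phi>) [hex (1/2) 0, hex (1/3) (1/3), 0])"
    by (simp add: orb)
  moreover have "map (\<lambda>p. card (stabilizer G \<phi> p)) [hex (1/2) 0, hex (1/3) (1/3), 0] = [2, 3, 6]"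
    by (simp add: card card_p6_fixing)
  ultimately show ?thesis
    unfolding has_cone_orders_def using ram by (intro exI conjI)
qed

section \<open>The image of the representation\<close>

text \<open>For \<open>a \<noteq> 0\<close> these are the matrices of determinant 1 whose action
  fixes \<infinity>.\<close>

definition upper_mat :: "complex \<Rightarrow> complex \<Rightarrow> complex^2^2" where
  "upper_mat a b = vector [vector [a, b], vector [0, 1 / a]]"

lemma to_PSL2C_hom: "to_PSL2C \<in> hom SL2C PSL2C"
proof -
  interpret normal "{mat 1, - mat 1}" SL2C by (rule normal_center_SL2C)
  show ?thesis
  proof (rule homI)
    show "to_PSL2C M \<in> carrier PSL2C" if "M \<in> carrier SL2C" for M
      using that by (auto simp: to_PSL2C_def PSL2C_def FactGroup_def RCOSETS_def)
    show "to_PSL2C (M \<otimes>\<^bsub>SL2C\<^esub> N) = to_PSL2C M \<otimes>\<^bsub>PSL2C\<^esub> to_PSL2C N"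
      if "M \<in> carrier SL2C" "N \<in> carrier SL2C" for M N
      using rcos_sum[OF that] by (simp add: to_PSL2C_def PSL2C_def FactGroup_def)
  qed
qed

lemma rho'_inf_hom: "rho'_inf \<in> hom trefoil_group PSL2C"
proof -
  interpret group PSL2C by (rule group_PSL2C)
  have "vector [vector [0, - 1], vector [1, 0]] \<in> carrier SL2C"
    by (simp add: SL2C_def det_2)
  then have flip: "flip \<in> carrier PSL2C"
    unfolding flip_def by (rule hom_in_carrier[OF to_PSL2C_hom])
  have rho': "rho' \<in> hom trefoil_group PSL2C"
    using rho_hom to_PSL2C_hom unfolding rho'_def[abs_def] hom_def by (auto simp: Pi_iff)
  have cancel: "inv\<^bsub>PSL2C\<^esub> flip \<otimes>\<^bsub>PSL2C\<^esub> (flip \<otimes>\<^bsub>PSL2C\<^esub> C) = C" if "C \<in> carrier PSL2C" for C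
    using that flip by (simp add: m_assoc[symmetric])
  show ?thesis
  proof (rule homI)
    show "rho'_inf x \<in> carrier PSL2C" if "x \<in> carrier trefoil_group" for x
      using hom_in_carrier[OF rho' that] flip by (simp add: rho'_inf_def)
    show "rho'_inf (x \<otimes>\<^bsub>trefoil_group\<^esub> y) = rho'_inf x \<otimes>\<^bsub>PSL2C\<^esub> rho'_inf y"
      if "x \<in> carrier trefoil_group" "y \<in> carrier trefoil_group" for x y
      using hom_in_carrier[OF rho' that(1)] hom_in_carrier[OF rho' that(2)] flip
      by (simp add: rho'_inf_def hom_mult[OF rho' that] m_assoc cancel)
  qed
qed

lemma group_hom_rho'_inf: "group_hom trefoil_group PSL2C rho'_inf"
  using rho'_inf_hom group_PSL2C group_presented_group[of trefoil_relators]
  by (simp add: group_hom_def group_hom_axioms_def trefoil_group_def)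

section \<open>Upper triangular classes and their affine maps\<close>

lemma upper_mat_closed: "a \<noteq> 0 \<Longrightarrow> upper_mat a b \<in> carrier SL2C"
  by (simp add: upper_mat_def SL2C_def det_2)

lemma upper_mat_mult:
  assumes "a \<noteq> 0" "c \<noteq> 0"
  shows "to_PSL2C (upper_mat a b) \<otimes>\<^bsub>PSL2C\<^esub> to_PSL2C (upper_mat c d) = to_PSL2C (upper_mat (a * c) (a * d + b / c))"
proof -
  have "upper_mat a b ** upper_mat c d = upper_mat (a * c) (a * d + b / c)"
    by (simp add: upper_mat_def vec_eq_iff forall_2 matrix_matrix_mult_def sum_2)
  then show ?thesis
    using hom_mult[OF to_PSL2C_hom upper_mat_closed upper_mat_closed, of a c b d] assms
    by (simp add: SL2C_def)
qed

lemma one_PSL2C: "\<one>\<^bsub>PSL2C\<^esub> = to_PSL2C (upper_mat 1 0)"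
proof -
  have "upper_mat 1 0 = mat 1"
    by (simp add: upper_mat_def vec_eq_iff forall_2 mat_def)
  then show ?thesis
    by (simp add: to_PSL2C_eq PSL2C_def FactGroup_def)
qed

lemma psl_act_upper_mat_infinity: "psl_act (to_PSL2C (upper_mat a b)) None = None"
  by (simp add: psl_act_to_PSL2C upper_mat_def)

lemma plane_act_upper_mat:
  assumes "a \<noteq> 0"
  shows "plane_act (to_PSL2C (upper_mat a b)) = (\<lambda>z. a\<^sup>2 * z + a * b)"
  using assms
  by (simp add: plane_act_def psl_act_to_PSL2C upper_mat_def moebius_def fun_eq_iff field_simps power2_eq_square)

text \<open>The affine map determines the square of \<open>a\<close> and the product
  \<open>a * b\<close>, hence the pair \<open>(a, b)\<close> up to a common sign, which is what
  passing to PSL forgets.\<close>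

lemma plane_act_upper_mat_inj:
  assumes "a \<noteq> 0" "c \<noteq> 0"
    and "plane_act (to_PSL2C (upper_mat a b)) = plane_act (to_PSL2C (upper_mat c d))"
  shows "to_PSL2C (upper_mat a b) = to_PSL2C (upper_mat c d)"
proof -
  have eq: "a\<^sup>2 * z + a * b = c\<^sup>2 * z + c * d" for z
    using assms(3) unfolding plane_act_upper_mat[OF assms(1)] plane_act_upper_mat[OF assms(2)] by (rule fun_cong)
  from eq[of 0] have ab: "a * b = c * d"
    by simp
  with eq[of 1] have "a\<^sup>2 = c\<^sup>2"
    by simp
  then consider "a = c" | "a = - c"
    by (auto simp: power2_eq_iff)
  then show ?thesis
  proof cases
    case 1
    then have "b = d" using ab assms by simp
    then show ?thesis using 1 by simp
  next
    case 2
    then have "c * (- b) = c * d" using ab by simp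
    then have "- b = d" using assms(2) by (metis mult_cancel_left)
    then have "b = - d" by (metis minus_minus)
    then have "upper_mat a b = - upper_mat c d"
      using 2 by (simp add: upper_mat_def vec_eq_iff forall_2)
    then show ?thesis by (simp add: to_PSL2C_eq insert_commute)
  qed
qed

text \<open>An upper bound for the image of the representation. Since \<open>plane_act\<close> is
  injective on it, faithfulness follows before the image is known exactly.\<close>

definition p6_classes :: "(complex^2^2) set set" where
  "p6_classes = {to_PSL2C (upper_mat a b) | a b. a \<noteq> 0 \<and> (\<lambda>z. a\<^sup>2 * z + a * b) \<in> p6}"

lemma p6_classesE:
  assumes "C \<in> p6_classes"
  obtains a b where "a \<noteq> 0" "C = to_PSL2C (upper_mat a b)" "(\<lambda>z. a\<^sup>2 * z + a * b) \<in> p6"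
  using assms by (auto simp: p6_classes_def)

lemma plane_act_mult:
  assumes "C \<in> p6_classes" "D \<in> p6_classes"
  shows "plane_act (C \<otimes>\<^bsub>PSL2C\<^esub> D) = (\<lambda>z. plane_act C (plane_act D z))"
  using assms
  by (elim p6_classesE)
    (simp add: upper_mat_mult plane_act_upper_mat fun_eq_iff field_simps power2_eq_square)

lemma plane_act_p6_classes: "C \<in> p6_classes \<Longrightarrow> plane_act C \<in> p6"
  by (elim p6_classesE) (simp add: plane_act_upper_mat)

lemma inj_on_plane_act: "inj_on plane_act p6_classes"
  by (rule inj_onI) (elim p6_classesE, use plane_act_upper_mat_inj in simp)

lemma subgroup_p6_classes: "subgroup p6_classes PSL2C"
proof -
  interpret group PSL2C by (rule group_PSL2C)
  have carrier: "p6_classes \<subseteq> carrier PSL2C"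
    using hom_in_carrier[OF to_PSL2C_hom upper_mat_closed] by (auto simp: p6_classes_def)
  show ?thesis
  proof (rule subgroupI[OF carrier])
    have "to_PSL2C (upper_mat 1 0) \<in> p6_classes"
      using id_in_p6 unfolding p6_classes_def by (intro CollectI exI[of _ 1] exI[of _ 0]) simp
    then show "p6_classes \<noteq> {}" by blast
  next
    fix C assume C: "C \<in> p6_classes"
    then obtain a b where a: "a \<noteq> 0" and Ceq: "C = to_PSL2C (upper_mat a b)" and p6: "(\<lambda>z. a\<^sup>2 * z + a * b) \<in> p6"
      by (rule p6_classesE)
    obtain g where g: "g \<in> p6" "\<And>z. g (a\<^sup>2 * z + a * b) = z"
      using p6_inverse[OF p6] by auto
    \<comment> \<open>The inverse in p6 has the coefficients of the inverse matrix, as seen by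
      applying it to a preimage of \<open>z\<close>.\<close>
    have "g z = (1 / a)\<^sup>2 * z + 1 / a * (- b)" for z
    proof -
      have "a\<^sup>2 * ((1 / a)\<^sup>2 * z + 1 / a * (- b)) + a * b = z"
        using a by (simp add: field_simps power2_eq_square)
      then show ?thesis
        using g(2)[of "(1 / a)\<^sup>2 * z + 1 / a * (- b)"] by simp
    qed
    then have "g = (\<lambda>z. (1 / a)\<^sup>2 * z + 1 / a * (- b))"
      by (rule ext)
    then have D: "to_PSL2C (upper_mat (1 / a) (- b)) \<in> p6_classes"
      using a g(1) unfolding p6_classes_def by (intro CollectI exI[of _ "1 / a"] exI[of _ "- b"]) simp
    have "to_PSL2C (upper_mat (1 / a) (- b)) \<otimes>\<^bsub>PSL2C\<^esub> C = \<one>\<^bsub>PSL2C\<^esub>"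
      using a by (simp add: Ceq upper_mat_mult one_PSL2C)
    from inv_equality[OF this] show "inv\<^bsub>PSL2C\<^esub> C \<in> p6_classes"
      using C D carrier by (simp add: subset_iff)
  next
    fix C D assume CD: "C \<in> p6_classes" "D \<in> p6_classes"
    obtain a b where "a \<noteq> 0" "C = to_PSL2C (upper_mat a b)"
      using CD(1) by (rule p6_classesE)
    moreover obtain c d where "c \<noteq> 0" "D = to_PSL2C (upper_mat c d)"
      using CD(2) by (rule p6_classesE)
    ultimately have *: "a \<noteq> 0" "C = to_PSL2C (upper_mat a b)" "c \<noteq> 0" "D = to_PSL2C (upper_mat c d)"
      by auto
    have "(\<lambda>z. plane_act C (plane_act D z)) \<in> p6"
      by (rule p6_comp[OF plane_act_p6_classes[OF CD(1)] plane_act_p6_classes[OF CD(2)]])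
    then have "plane_act (C \<otimes>\<^bsub>PSL2C\<^esub> D) \<in> p6"
      by (simp add: plane_act_mult CD)
    moreover have CD_eq: "C \<otimes>\<^bsub>PSL2C\<^esub> D = to_PSL2C (upper_mat (a * c) (a * d + b / c))"
      using * by (simp add: upper_mat_mult)
    moreover have "a * c \<noteq> 0"
      using * by simp
    ultimately show "C \<otimes>\<^bsub>PSL2C\<^esub> D \<in> p6_classes"
      unfolding p6_classes_def CD_eq
      by - (rule CollectI, rule exI[of _ "a * c"], rule exI[of _ "a * d + b / c"], simp add: plane_act_upper_mat)
  qed
qed

section \<open>The image of the representation on generators and words\<close>

lemma rho'_inf_generator:
  "rho'_inf (word_class trefoil_relators [(Gen_a, True)]) = to_PSL2C (upper_mat (cis (- (pi / 6))) 0)"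
  "rho'_inf (word_class trefoil_relators [(Gen_b, True)]) = to_PSL2C (upper_mat (cis (- (pi / 6))) (- 1))"
proof -
  have c: "word_class trefoil_relators [(x, True)] \<in> carrier trefoil_group" for x
    by (simp add: trefoil_group_def presented_group_def)
  have s: "Complex (sqrt 3 / 2) (- 1 / 2) = cis (- (pi / 6))"
    by (simp add: complex_eq_iff cos_30 sin_30)
  have "cis (pi / 6) * cis (- (pi / 6)) = 1"
    by (simp add: cis_mult)
  then have "cis (pi / 6) = 1 / cis (- (pi / 6))"
    by (intro eq_divide_imp cis_neq_zero)
  moreover have "Complex (sqrt 3 / 2) (1 / 2) = cis (pi / 6)"
    by (simp add: complex_eq_iff cos_30 sin_30)
  ultimately have p: "Complex (sqrt 3 / 2) (1 / 2) = 1 / cis (- (pi / 6))"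
    by simp
  show "rho'_inf (word_class trefoil_relators [(Gen_a, True)]) = to_PSL2C (upper_mat (cis (- (pi / 6))) 0)"
    using rho'_inf_eq[OF rho_generator[of Gen_a, unfolded rho_gen.simps] c] by (simp only: upper_mat_def s p minus_zero)
  show "rho'_inf (word_class trefoil_relators [(Gen_b, True)]) = to_PSL2C (upper_mat (cis (- (pi / 6))) (- 1))"
    using rho'_inf_eq[OF rho_generator[of Gen_b, unfolded rho_gen.simps] c] by (simp only: upper_mat_def s p minus_zero)
qed

text \<open>Squaring \<open>cis (- (pi / 6))\<close> gives the inverse of
  \<open>cis (pi / 3)\<close>, whence the exponent 5. The entry -1 yields the translation
  \<open>hex 0 1\<close>.\<close>

lemma plane_act_generator:
  "plane_act (rho'_inf (word_class trefoil_relators [(Gen_a, True)])) = p6_map 5 0 0"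
  "plane_act (rho'_inf (word_class trefoil_relators [(Gen_b, True)])) = p6_map 5 0 1"
proof -
  have "cis (pi / 3) ^ 5 = cis (real 5 * (pi / 3))"
    by (rule Complex.DeMoivre)
  also have "\<dots> = cis (- (pi / 3) + 2 * pi)"
    by (rule arg_cong[of _ _ cis]) simp
  also have "\<dots> = cis (- (pi / 3))"
    by (simp only: cis_mult[symmetric] cis_2pi mult_1_right)
  also have "\<dots> = cis (- (pi / 6)) ^ 2"
    by (simp add: power2_eq_square cis_mult)
  finally have sq: "cis (pi / 3) ^ 5 = cis (- (pi / 6)) ^ 2" .
  have "- cis (- (pi / 6)) = hex 0 1"
    by (simp add: hex_Complex complex_eq_iff cos_30 sin_30)
  then show
    "plane_act (rho'_inf (word_class trefoil_relators [(Gen_a, True)])) = p6_map 5 0 0"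
    "plane_act (rho'_inf (word_class trefoil_relators [(Gen_b, True)])) = p6_map 5 0 1"
    by (simp_all add: rho'_inf_generator plane_act_upper_mat p6_map_def fun_eq_iff sq)
qed

text \<open>Induction on words: inverse letters are handled by closure of \<open>p6_classes\<close>
  under inverses.\<close>

lemma rho'_inf_image_subset: "rho'_inf ` carrier trefoil_group \<subseteq> p6_classes"
proof -
  interpret H: group_hom trefoil_group PSL2C rho'_inf
    by (rule group_hom_rho'_inf)
  let ?c = "word_class trefoil_relators"
  have c: "?c w \<in> carrier trefoil_group" for w
    by (simp add: trefoil_group_def presented_group_def)
  have mult: "?c u \<otimes>\<^bsub>trefoil_group\<^esub> ?c v = ?c (u @ v)" for u v
    by (simp add: trefoil_group_def presented_group_mult)
  have one: "\<one>\<^bsub>trefoil_group\<^esub> = ?c []"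
    by (simp add: trefoil_group_def presented_group_def)
  have gen: "rho'_inf (?c [(x, True)]) \<in> p6_classes" for x
  proof -
    have "(\<lambda>z. (cis (- (pi / 6)))\<^sup>2 * z + cis (- (pi / 6)) * 0) \<in> p6"
      "(\<lambda>z. (cis (- (pi / 6)))\<^sup>2 * z + cis (- (pi / 6)) * (- 1)) \<in> p6"
      using p6_map_in_p6[of 5 0 0] p6_map_in_p6[of 5 0 1]
      unfolding plane_act_generator[symmetric] rho'_inf_generator plane_act_upper_mat[OF cis_neq_zero] .
    then show ?thesis
      unfolding p6_classes_def by (cases x) (auto simp only: rho'_inf_generator intro!: cis_neq_zero)
  qed
  have "rho'_inf (?c [(x, False)]) \<in> p6_classes" for x
  proof -
    have "word_eq trefoil_relators [(x, False), (x, \<not> False)] []"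
      by (rule word_eq.cancel)
    then have "?c [(x, False)] \<otimes>\<^bsub>trefoil_group\<^esub> ?c [(x, True)] = \<one>\<^bsub>trefoil_group\<^esub>"
      by (simp add: mult one word_class_eq_iff)
    then have "?c [(x, False)] = inv\<^bsub>trefoil_group\<^esub> (?c [(x, True)])"
      using H.G.inv_equality c by metis
    then show ?thesis
      using subgroup.m_inv_closed[OF subgroup_p6_classes gen] c by simp
  qed
  with gen have letter: "rho'_inf (?c [l]) \<in> p6_classes" for l
    by (cases l; cases "snd l") auto
  have "rho'_inf (?c w) \<in> p6_classes" for w
  proof (induction w)
    case Nil
    show ?case
      using subgroup.one_closed[OF subgroup_p6_classes] by (simp flip: one)
  next
    case (Cons l w)
    have "rho'_inf (?c (l # w)) = rho'_inf (?c [l]) \<otimes>\<^bsub>PSL2C\<^esub> rho'_inf (?c w)"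
      using mult[of "[l]" w] c by (simp flip: H.hom_mult)
    then show ?case
      using subgroup.m_closed[OF subgroup_p6_classes letter Cons.IH] by simp
  qed
  then show ?thesis
    by (auto simp: trefoil_group_def presented_group_def)
qed

lemma subgroup_rho'_inf_image: "subgroup (rho'_inf ` carrier trefoil_group) PSL2C"
proof -
  interpret H: group_hom trefoil_group PSL2C rho'_inf
    by (rule group_hom_rho'_inf)
  show ?thesis by (rule H.img_is_subgroup)
qed

text \<open>Closure under composition suffices: rotations have finite order, and conjugation by a
  half-turn inverts a translation, so inverses come for free.\<close>

lemma p6_generated:
  assumes comp: "\<And>f g. f \<in> S \<Longrightarrow> g \<in> S \<Longrightarrow> (\<lambda>z. f (g z)) \<in> S"
    and gens: "p6_map 5 0 0 \<in> S" "p6_map 5 0 1 \<in> S"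
  shows "p6 \<subseteq> S"
proof -
  have pow5: "p6_map (5 * Suc k) 0 0 \<in> S" for k
  proof (induction k)
    case (Suc k)
    have "p6_map (5 * Suc (Suc k)) 0 0 = (\<lambda>z. p6_map 5 0 0 (p6_map (5 * Suc k) 0 0 z))"
      by (simp add: fun_eq_iff p6_map_def power_add)
    then show ?case using comp[OF gens(1) Suc.IH] by simp
  qed (use gens in simp)
  have rot: "p6_map k 0 0 \<in> S" for k
  proof -
    \<comment> \<open>As 5 is its own inverse modulo 6, the power \<open>5 * k\<close> of the
      generator is rotation number \<open>k\<close>. Adding 6 keeps the power positive, since
      \<open>S\<close> is not assumed to contain the identity.\<close>
    have eq: "5 * Suc (5 * k + 5) = k + 6 * (4 * k + 5)"
      by simp
    have "5 * Suc (5 * k + 5) mod 6 = k mod 6"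
      unfolding eq by (rule mod_mult_self2)
    then have "p6_map k 0 0 = p6_map (5 * Suc (5 * k + 5)) 0 0"
      by (subst (1 2) p6_map_mod[symmetric]) (simp only:)
    then show ?thesis using pow5[of "5 * k + 5"] by (simp only:)
  qed
  have conj: "(\<lambda>z. p6_map k 0 0 (f (p6_map l 0 0 z))) \<in> S" if "f \<in> S" for f k l
    using comp[OF rot[of k] comp[OF that rot[of l]]] .
  have ext: "f = g" if "\<And>x y. f (hex x y) = g (hex x y)" for f g :: "complex \<Rightarrow> complex"
  proof
    show "f z = g z" for z
      by (cases z rule: hex_cases) (simp add: that)
  qed
  \<comment> \<open>Cancelling the rotation part of the second generator isolates a lattice
    translation; conjugation by rotations then supplies the other basis vector and the
    negatives.\<close>
  have "p6_map 0 0 1 = (\<lambda>z. p6_map 5 0 1 (p6_map 1 0 0 z))"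
    by (rule ext) (simp only: p6_map_hex, simp)
  then have n: "p6_map 0 0 1 \<in> S"
    using comp[OF gens(2) rot[of 1]] by simp
  have "p6_map 0 0 (- 1) = (\<lambda>z. p6_map 3 0 0 (p6_map 0 0 1 (p6_map 3 0 0 z)))"
    by (rule ext) (simp only: p6_map_hex, simp)
  then have n': "p6_map 0 0 (- 1) \<in> S"
    using conj[OF n] by simp
  have "p6_map 0 1 0 = (\<lambda>z. p6_map 5 0 0 (p6_map 0 0 1 (p6_map 1 0 0 z)))"
    by (rule ext) (simp only: p6_map_hex, simp)
  then have m: "p6_map 0 1 0 \<in> S"
    using conj[OF n, of 5 1] by simp
  have "p6_map 0 (- 1) 0 = (\<lambda>z. p6_map 3 0 0 (p6_map 0 1 0 (p6_map 3 0 0 z)))"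
    by (rule ext) (simp only: p6_map_hex, simp)
  then have m': "p6_map 0 (- 1) 0 \<in> S"
    using conj[OF m] by simp
  have add: "p6_map 0 (m + m') (n + n') \<in> S" if "p6_map 0 m n \<in> S" "p6_map 0 m' n' \<in> S" for m n m' n'
  proof -
    have "p6_map 0 (m + m') (n + n') = (\<lambda>z. p6_map 0 m n (p6_map 0 m' n' z))"
      by (rule ext) (simp add: p6_map_hex)
    then show ?thesis using comp[OF that] by simp
  qed
  have N: "p6_map 0 0 n \<in> S" for n
  proof (induction n rule: int_induct[of _ 0])
    case base
    show ?case by (rule rot)
  next
    case (step1 i)
    show ?case using add[OF step1(2) n] by simp
  next
    case (step2 i)
    show ?case using add[OF step2(2) n'] by simp
  qed
  have M: "p6_map 0 m 0 \<in> S" for m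
  proof (induction m rule: int_induct[of _ 0])
    case base
    show ?case by (rule rot)
  next
    case (step1 i)
    show ?case using add[OF step1(2) m] by simp
  next
    case (step2 i)
    show ?case using add[OF step2(2) m'] by simp
  qed
  have "p6_map k m n \<in> S" for k m n
  proof -
    have "p6_map k m n = (\<lambda>z. p6_map 0 m n (p6_map k 0 0 z))"
      by (simp add: fun_eq_iff p6_map_def)
    then show ?thesis
      using comp[OF add[OF M[of m] N[of n]] rot[of k]] by simp
  qed
  then show ?thesis
    by (auto simp: p6_def)
qed

lemma plane_act_image: "plane_act ` rho'_inf ` carrier trefoil_group = p6"
proof
  let ?I = "rho'_inf ` carrier trefoil_group"
  show "plane_act ` ?I \<subseteq> p6"
    using rho'_inf_image_subset plane_act_p6_classes by blast
  show "p6 \<subseteq> plane_act ` ?I"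
  proof (rule p6_generated)
    fix f g assume "f \<in> plane_act ` ?I" "g \<in> plane_act ` ?I"
    then obtain C D where CD: "C \<in> ?I" "D \<in> ?I" and fg: "f = plane_act C" "g = plane_act D"
      by blast
    have "(\<lambda>z. f (g z)) = plane_act (C \<otimes>\<^bsub>PSL2C\<^esub> D)"
      using plane_act_mult[of C D] subsetD[OF rho'_inf_image_subset] CD by (simp add: fg)
    then show "(\<lambda>z. f (g z)) \<in> plane_act ` ?I"
      using subgroup.m_closed[OF subgroup_rho'_inf_image CD] by simp
  next
    have "word_class trefoil_relators w \<in> carrier trefoil_group" for w
      by (simp add: trefoil_group_def presented_group_def)
    then show "p6_map 5 0 0 \<in> plane_act ` ?I" "p6_map 5 0 1 \<in> plane_act ` ?I"
      unfolding plane_act_generator[symmetric] by blast+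
  qed
qed

section \<open>Transfer from p6 to the image group\<close>

lemma orientation_preserving_isometry_p6:
  assumes "f \<in> p6"
  shows "orientation_preserving_isometry f"
proof -
  obtain k m n where "f = p6_map k m n"
    using assms by (rule p6E)
  then show ?thesis
    unfolding orientation_preserving_isometry_def
    by (intro exI[of _ "cis (pi / 3) ^ k"] exI[of _ "hex m n"]) (simp add: p6_map_def fun_eq_iff norm_power)
qed

lemma p6_subset_Bij: "p6 \<subseteq> Bij UNIV"
proof
  fix f assume "f \<in> p6"
  then obtain g where "\<And>z. g (f z) = z" "\<And>z. f (g z) = z"
    using p6_inverse[of f] by auto
  then have "bij f"
    by (intro bij_betwI[of _ _ _ g]) auto
  then show "f \<in> Bij UNIV"
    by (simp add: Bij_def extensional_def)
qed

text \<open>Composition of affine maps matches multiplication in PSL on \<open>p6_classes\<close>,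
  and injectivity there restricts to the image.\<close>

lemma faithful_action_plane_act:
  "faithful_action (PSL2C\<lparr>carrier := rho'_inf ` carrier trefoil_group\<rparr>) UNIV plane_act"
proof -
  let ?G = "PSL2C\<lparr>carrier := rho'_inf ` carrier trefoil_group\<rparr>"
  have "plane_act \<in> hom ?G (BijGroup UNIV)"
  proof (rule homI)
    fix C assume "C \<in> carrier ?G"
    then have "plane_act C \<in> p6"
      using plane_act_image by auto
    then show "plane_act C \<in> carrier (BijGroup UNIV)"
      using p6_subset_Bij by (auto simp: BijGroup_def)
  next
    fix C D assume CD: "C \<in> carrier ?G" "D \<in> carrier ?G"
    then have "C \<in> p6_classes" "D \<in> p6_classes"
      using rho'_inf_image_subset by auto
    moreover from this have "plane_act C \<in> Bij UNIV" "plane_act D \<in> Bij UNIV"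
      using plane_act_p6_classes p6_subset_Bij by blast+
    ultimately show "plane_act (C \<otimes>\<^bsub>?G\<^esub> D) = plane_act C \<otimes>\<^bsub>BijGroup UNIV\<^esub> plane_act D"
      by (simp add: BijGroup_def compose_def plane_act_mult fun_eq_iff)
  qed
  moreover have "group ?G"
    by (rule subgroup.subgroup_is_group[OF subgroup_rho'_inf_image group_PSL2C])
  ultimately have "group_action ?G UNIV plane_act"
    by (simp add: group_action_def group_hom_def group_hom_axioms_def group_BijGroup)
  moreover have "inj_on plane_act (carrier ?G)"
    using inj_on_subset[OF inj_on_plane_act rho'_inf_image_subset] by simp
  ultimately show ?thesis
    by (simp add: faithful_action_def faithful_action_axioms_def)
qed

lemma properly_discontinuous_p6:
  assumes image: "\<phi> ` carrier G = p6" and inj: "inj_on \<phi> (carrier G)"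
  shows "properly_discontinuous G \<phi>"
  unfolding properly_discontinuous_def
proof (intro allI impI)
  fix K :: "complex set"
  assume "compact K"
  then have "finite {f \<in> p6. f ` K \<inter> K \<noteq> {}}"
    by (intro finite_p6_meeting_bounded compact_imp_bounded)
  moreover have "\<phi> ` {g \<in> carrier G. \<phi> g ` K \<inter> K \<noteq> {}} = {f \<in> p6. f ` K \<inter> K \<noteq> {}}"
    unfolding image[symmetric] by auto
  ultimately have "finite (\<phi> ` {g \<in> carrier G. \<phi> g ` K \<inter> K \<noteq> {}})"
    by (simp only:)
  moreover have "inj_on \<phi> {g \<in> carrier G. \<phi> g ` K \<inter> K \<noteq> {}}"
    using inj by (rule inj_on_subset) auto
  ultimately show "finite {g \<in> carrier G. \<phi> g ` K \<inter> K \<noteq> {}}"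
    by (rule finite_imageD)
qed

theorem theorem3:
  shows "(\<forall>C \<in> rho'_inf ` carrier trefoil_group. psl_act C None = None) \<and>
    acts_as_sphere_orbifold_holonomy
      (PSL2C\<lparr>carrier := rho'_inf ` carrier trefoil_group\<rparr>) plane_act [2, 3, 6]"
proof
  let ?G = "PSL2C\<lparr>carrier := rho'_inf ` carrier trefoil_group\<rparr>"
  show "\<forall>C \<in> rho'_inf ` carrier trefoil_group. psl_act C None = None"
  proof
    fix C assume "C \<in> rho'_inf ` carrier trefoil_group"
    then have "C \<in> p6_classes"
      using rho'_inf_image_subset by blast
    then show "psl_act C None = None"
      by (elim p6_classesE) (simp add: psl_act_upper_mat_infinity)
  qed
  have image: "plane_act ` carrier ?G = p6"
    using plane_act_image by simp
  have inj: "inj_on plane_act (carrier ?G)"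
    using faithful_action_plane_act by (rule faithful_action.faithful)
  have one: "\<one>\<^bsub>?G\<^esub> \<in> carrier ?G"
    using subgroup.one_closed[OF subgroup_rho'_inf_image] by simp
  have "plane_act \<one>\<^bsub>?G\<^esub> = (\<lambda>z. z)"
    by (simp add: one_PSL2C plane_act_upper_mat)
  then show "acts_as_sphere_orbifold_holonomy ?G plane_act [2, 3, 6]"
    unfolding acts_as_sphere_orbifold_holonomy_def
    using faithful_action_plane_act properly_discontinuous_p6[OF image inj]
      orbit_space_p6_homeomorphic_sphere[OF image] p6_cone_orders[OF image inj one]
      orientation_preserving_isometry_p6 image
    by blast
qed

end
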